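(* Let $\mathbf U_h^C$ be, componentwise, a polynomial of total degree at most $k$ on each primal cell $I_{i,j}$, and $\mathbf U_h^D$ be, componentwise, a polynomial of total degree at most $k$ on each dual cell $I_{i+\frac12,j+\frac12}$. Assume that $\overline{\mathbf U}_{ij}^C\in G$ and $\overline{\mathbf U}_{i+\frac12,j+\frac12}^D\in G$ for all $i,j$, and that $$\mathbf U_h^C(x,y)\in G,\qquad \mathbf U_h^D(x,y)\in G\qquad\forall (x,y)\in\bigcup_{i,j}\mathbb Q_{ij},\qquad \mathbb Q_{ij}:=(\mathbb Q_i^x\otimes\hat{\mathbb Q}_j^y)\cup(\hat{\mathbb Q}_i^x\otimes\mathbb Q_j^y).$$ Let $a_1\ge\hat a_1$, $a_2\ge\hat a_2$, and let $\Delta t>0$, $\tau_{\max}>0$ satisfy the CFL condition $$\lambda=\frac{a_1\Delta t}{\Delta x}+\frac{a_2\Delta t}{\Delta y}<\frac{\theta\hat\omega_1}{2},\qquad\theta=\frac{\Delta t}{\tau_{\max}}\in(0,1].$$ Then for all $i,j$ the updated cell averages $$\mathbf U_{\Delta t}^C:=\overline{\mathbf U}_{ij}^C+\Delta t\,\mathcal L_{ij}(\mathbf U_h^C,\mathbf U_h^D),\qquad \mathbf U_{\Delta t}^D:=\overline{\mathbf U}_{i+\frac12,j+\frac12}^D+\Delta t\,\mathcal L_{i+\frac12,j+\frac12}(\mathbf U_h^D,\mathbf U_h^C)$$ satisfy, for all $\mathbf v^*,\mathbf B^*\in\mathbb R^3$, $$\mathbf U_{\Delta t}^C\cdot\mathbf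 n_1>0,\qquad \mathbf U_{\Delta t}^D\cdot\mathbf n_1>0,$$ $$\mathbf U_{\Delta t}^C\cdot\mathbf n^*+\frac{|\mathbf B^*|^2}{2}>\frac{\theta\hat\omega_1}{2}\Big((\mathbf\Pi_{ij}^{L,-}+\mathbf\Pi_{ij}^{1,+})\cdot\mathbf n^*+|\mathbf B^*|^2\Big)-\Delta t\,(\mathbf v^*\cdot\mathbf B^* )\,\mathrm{div}_{ij}\mathbf B_h^D,$$ $$\mathbf U_{\Delta t}^D\cdot\mathbf n^*+\frac{|\mathbf B^*|^2}{2}>\frac{\theta\hat\omega_1}{2}\Big((\mathbf\Pi_{i+\frac12,j+\frac12}^{L,-}+\mathbf\Pi_{i+\frac12,j+\frac12}^{1,+})\cdot\mathbf n^*+|\mathbf B^*|^2\Big)-\Delta t\,(\mathbf v^*\cdot\mathbf B^* )\,\mathrm{div}_{i+\frac12,j+\frac12}\mathbf B_h^C .$$ Furthermore, if in addition $$\mathrm{div}_{ij}\mathbf B_h^D=0,\qquad \mathrm{div}_{i+\frac12,j+\frac12}\mathbf B_h^C=0\qquad\forall i,j,$$ then $\mathbf U_{\Delta t}^C\in G$ and $\mathbf U_{\Delta t}^D\in G$ for all $i,j$.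
   Context: **Ideal MHD.** States are $\mathbf U=(\rho,\mathbf m,\mathbf B,E)^\top\in\mathbb R^8$ with $\mathbf m,\mathbf B\in\mathbb R^3$. Put $\mathbf v=\mathbf m/\rho$, $\mathcal E(\mathbf U)=E-\frac{|\mathbf m|^2}{2\rho}-\frac{|\mathbf B|^2}{2}=\rho e$ (this defines the specific internal energy $e$), and $p=p(\rho,e)$ given by an equation of state for which $p>0\Leftrightarrow e>0$ (when $\rho>0$). The flux in direction $\ell$ is $$\mathbf F_\ell(\mathbf U)=\Big(\rho v_\ell,\ v_\ell\mathbf m-B_\ell\mathbf B+(p+\tfrac12|\mathbf B|^2)\mathbf e_\ell,\ v_\ell\mathbf B-B_\ell\mathbf v,\ v_\ell(E+p+\tfrac12|\mathbf B|^2)-B_\ell(\mathbf v\cdot\mathbf B)\Big)^\top,$$ with $\mathbf e_\ell$ the $\ell$th column of the $3\times3$ identity matrix. The admissible set is $G=\{\mathbf U:\rho>0,\ \mathcal E(\mathbf U)>0\}$. Also $\mathbf n_1=(1,0,\dots,0)^\top\in\mathbb R^8$ and, for $\mathbf v^*,\mathbf B^*\in\mathbb R^3$, $\mathbf n^*=(\frac{|\mathbf v^*|^2}{2},-\mathbf v^*,-\mathbf B^*,1)^\top\in\mathbb R^8$. **Wave speed bound.** For $\mathbf U,\tilde{\mathbf U}\in G$ (tilde denotes quantities of $\tilde{\mathbf U}$), $$\alpha_\ell(\mathbf U,\tilde{\mathbf U})=\max\Big\{|v_\ell|+\mathcal C_\ell,\ |\tilde v_\ell|+\tilde{\mathcal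 C}_\ell,\ \frac{|\sqrt\rho v_\ell+\sqrt{\tilde\rho}\tilde v_\ell|}{\sqrt\rho+\sqrt{\tilde\rho}}+\max\{\mathcal C_\ell,\tilde{\mathcal C}_\ell\}\Big\}+\frac{|\mathbf B-\tilde{\mathbf B}|}{\sqrt\rho+\sqrt{\tilde\rho}},$$ $$\mathcal C_\ell=\frac1{\sqrt2}\Big[\frac{|\mathbf B|^2}{\rho}+\mathcal C_s^2+\sqrt{\big(\tfrac{|\mathbf B|^2}{\rho}+\mathcal C_s^2\big)^2-4\tfrac{B_\ell^2\mathcal C_s^2}{\rho}}\Big]^{1/2},\qquad \mathcal C_s=\frac{p}{\rho\sqrt{2e}} .$$ **Meshes.** A rectangle is covered by two overlapping uniform meshes with step sizes $\Delta x,\Delta y$: primal cells $I_{i,j}=(x_{i-\frac12},x_{i+\frac12})\times(y_{j-\frac12},y_{j+\frac12})$ with center $(x_i,y_j)$, and dual cells $I_{i+\frac12,j+\frac12}=(x_i,x_{i+1})\times(y_j,y_{j+1})$. Indices $i,j$ range over all mesh indices; values needed beyond the boundary are supplied by boundary conditions and subject to the same hypotheses. $\mathbf B_h^C=(B_{1,h}^C,B_{2,h}^C,B_{3,h}^C)$ and $\mathbf B_h^D$ are the magnetic components of $\mathbf U_h^C,\mathbf U_h^D$. For $\star\in\{C,D\}$, $\overline{\mathbf U}^\star_{ij}$ and $\overline{\mathbf U}^\star_{i+\frac12,j+\frac12}$ denote the averages of $\mathbf U_h^\star$ over $I_{i,j}$ and $I_{i+\frac12,j+\frac12}$. **Quadrature.**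 Let $N=k+1$, $L=\lceil\frac{k+3}2\rceil$. $\{x_{i\pm\frac14}^{(\mu)}\}_{\mu=1}^N$ are the $N$-point Gauss nodes on the half-intervals: subscript $i-\frac14$ refers to $[x_{i-\frac12},x_i]$, subscript $i+\frac14$ to $[x_i,x_{i+\frac12}]$; weights $\omega_\mu$, $\sum_\mu\omega_\mu=1$; $\mathbb Q_i^x$ is the union of these two node sets. $\{\hat x_{i\pm\frac14}^{(\nu)}\}_{\nu=1}^L$ are the $L$-point Gauss–Lobatto nodes (endpoints included, increasing order) on the same half-intervals; weights $\hat\omega_\nu$, $\sum_\nu\hat\omega_\nu=1$; $\hat{\mathbb Q}_i^x$ is the union. The sets $\mathbb Q_j^y,\hat{\mathbb Q}_j^y$ and nodes $y_{j\pm\frac14}^{(\mu)},\hat y_{j\pm\frac14}^{(\nu)}$ are defined likewise. The same convention is used for shifted subscripts (e.g. $i+\frac12\pm\frac14$ refers to the half-intervals $[x_i,x_{i+\frac12}]$ and $[x_{i+\frac12},x_{i+1}]$). At nodes where a piecewise polynomial is discontinuous, its value is the one-sided limit from within the half-interval to which the node belongs (both limits, if it belongs to both). **Scheme (cell averages of the standard central DG method).** $$\mathcal L_{ij}(\mathbf U_h^C,\mathbf U_h^D)=\frac{\overline{\mathbf U}_{ij}^D-\overline{\mathbf U}_{ij}^C}{\tau_{\max}}-\frac1{\Delta x}\sum_{\sigma=\pm1}\sum_{\mu=1}^N\frac{\omega_\mu}2\Big(\mathbf F_1(\mathbf U_h^D(x_{i+\frac12},y_{j+\frac\sigma4}^{(\mu)}))-\mathbf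 F_1(\mathbf U_h^D(x_{i-\frac12},y_{j+\frac\sigma4}^{(\mu)}))\Big)$$ $$\qquad-\frac1{\Delta y}\sum_{\sigma=\pm1}\sum_{\mu=1}^N\frac{\omega_\mu}2\Big(\mathbf F_2(\mathbf U_h^D(x_{i+\frac\sigma4}^{(\mu)},y_{j+\frac12}))-\mathbf F_2(\mathbf U_h^D(x_{i+\frac\sigma4}^{(\mu)},y_{j-\frac12}))\Big),$$ and $\mathcal L_{i+\frac12,j+\frac12}(\mathbf U_h^D,\mathbf U_h^C)$ is the same expression with the roles of $C$ and $D$ exchanged and $i,j$ replaced by $i+\frac12,j+\frac12$ everywhere. **Discrete divergence.** $$\mathrm{div}_{ij}\mathbf B_h^D=\frac1{\Delta x}\sum_{\sigma=\pm1}\sum_{\mu=1}^N\frac{\omega_\mu}2\Big(B_{1,h}^D(x_{i+\frac12},y_{j+\frac\sigma4}^{(\mu)})-B_{1,h}^D(x_{i-\frac12},y_{j+\frac\sigma4}^{(\mu)})\Big)+\frac1{\Delta y}\sum_{\sigma=\pm1}\sum_{\mu=1}^N\frac{\omega_\mu}2\Big(B_{2,h}^D(x_{i+\frac\sigma4}^{(\mu)},y_{j+\frac12})-B_{2,h}^D(x_{i+\frac\sigma4}^{(\mu)},y_{j-\frac12})\Big),$$ and $\mathrm{div}_{i+\frac12,j+\frac12}\mathbf B_h^C$ is the same with $D\to C$, $(i,j)\to(i+\frac12,j+\frac12)$. **Wave speeds and $\mathbf\Pi$.** $$\hat a_1=\max_{i,j}\max_{y\in\mathbb Q_j^y}\big\{\alpha_1(\mathbf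 U_h^C(x_{i+1},y),\mathbf U_h^C(x_i,y)),\ \alpha_1(\mathbf U_h^D(x_{i+\frac12},y),\mathbf U_h^D(x_{i-\frac12},y))\big\},$$ $$\hat a_2=\max_{i,j}\max_{x\in\mathbb Q_i^x}\big\{\alpha_2(\mathbf U_h^C(x,y_{j+1}),\mathbf U_h^C(x,y_j)),\ \alpha_2(\mathbf U_h^D(x,y_{j+\frac12}),\mathbf U_h^D(x,y_{j-\frac12}))\big\}.$$ With $\lambda_1=\frac{a_1\Delta t}{\Delta x}$, $\lambda_2=\frac{a_2\Delta t}{\Delta y}$, $\lambda=\lambda_1+\lambda_2$, $$\mathbf\Pi_{ij}^{\nu,\pm}=\frac{\lambda_1}{\lambda}\sum_{\sigma=\pm1}\sum_{\mu=1}^N\frac{\omega_\mu}2\mathbf U_h^D(\hat x_{i\pm\frac14}^{(\nu)},y_{j+\frac\sigma4}^{(\mu)})+\frac{\lambda_2}{\lambda}\sum_{\sigma=\pm1}\sum_{\mu=1}^N\frac{\omega_\mu}2\mathbf U_h^D(x_{i+\frac\sigma4}^{(\mu)},\hat y_{j\pm\frac14}^{(\nu)}),$$ and $\mathbf\Pi_{i+\frac12,j+\frac12}^{\nu,\pm}$ is the same with $D\to C$, $(i,j)\to(i+\frac12,j+\frac12)$. *)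

theory Defs
  imports "HOL-Analysis.Analysis" "HOL-Computational_Algebra.Polynomial"
begin

section \<open>Ideal MHD\<close>

text \<open>
  The state \<open>(\<rho>, m, B, E)\<close>. Its Euclidean structure as a product space is that of
  the eight-dimensional Euclidean space, so \<open>\<bullet>\<close> is the usual dot product.
\<close>

type_synonym vec3 = "real ^ 3"
type_synonym state = "real \<times> vec3 \<times> vec3 \<times> real"

definition rho :: "state \<Rightarrow> real" where "rho U = fst U"
definition mom :: "state \<Rightarrow> vec3" where "mom U = fst (snd U)"
definition mag :: "state \<Rightarrow> vec3" where "mag U = fst (snd (snd U))"
definition ener :: "state \<Rightarrow> real" where "ener U = snd (snd (snd U))"

definition vel :: "state \<Rightarrow> vec3" where
  "vel U = mom U /\<^sub>R rho U"

definition internal_energy :: "state \<Rightarrow> real" where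
  "internal_energy U = ener U - (norm (mom U))\<^sup>2 / (2 * rho U) - (norm (mag U))\<^sup>2 / 2"

definition specific_energy :: "state \<Rightarrow> real" where
  "specific_energy U = internal_energy U / rho U"

type_synonym eos = "real \<Rightarrow> real \<Rightarrow> real"  \<comment> \<open>arguments: density, specific internal energy\<close>

definition pressure :: "eos \<Rightarrow> state \<Rightarrow> real" where
  "pressure p U = p (rho U) (specific_energy U)"

definition admissible :: "state set" where
  "admissible = {U. rho U > 0 \<and> internal_energy U > 0}"

definition flux :: "eos \<Rightarrow> 3 \<Rightarrow> state \<Rightarrow> state" where
  "flux p l U =
    (let v = vel U; B = mag U; ptot = pressure p U + (norm B)\<^sup>2 / 2 in
      (rho U * v $ l,
       (v $ l) *\<^sub>R mom U - (B $ l) *\<^sub>R B + ptot *\<^sub>R axis l 1,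
       (v $ l) *\<^sub>R B - (B $ l) *\<^sub>R v,
       (v $ l) * (ener U + ptot) - (B $ l) * (v \<bullet> B)))"

definition n_one :: state where
  "n_one = (1, 0, 0, 0)"

definition n_star :: "vec3 \<Rightarrow> vec3 \<Rightarrow> state" where
  "n_star vs Bs = ((norm vs)\<^sup>2 / 2, - vs, - Bs, 1)"

definition sound_speed :: "eos \<Rightarrow> state \<Rightarrow> real" where
  "sound_speed p U = pressure p U / (rho U * sqrt (2 * specific_energy U))"

definition fast_speed :: "eos \<Rightarrow> 3 \<Rightarrow> state \<Rightarrow> real" where
  "fast_speed p l U =
    (let b = (norm (mag U))\<^sup>2 / rho U + (sound_speed p U)\<^sup>2 in
      1 / sqrt 2 *
        sqrt (b + sqrt (b\<^sup>2 - 4 * ((mag U $ l)\<^sup>2 * (sound_speed p U)\<^sup>2 / rho U))))"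

definition wave_bound :: "eos \<Rightarrow> 3 \<Rightarrow> state \<Rightarrow> state \<Rightarrow> real" where
  "wave_bound p l U V =
    Max {\<bar>vel U $ l\<bar> + fast_speed p l U,
         \<bar>vel V $ l\<bar> + fast_speed p l V,
         \<bar>sqrt (rho U) * vel U $ l + sqrt (rho V) * vel V $ l\<bar> / (sqrt (rho U) + sqrt (rho V))
           + max (fast_speed p l U) (fast_speed p l V)}
    + norm (mag U - mag V) / (sqrt (rho U) + sqrt (rho V))"


section \<open>Gauss and Gauss--Lobatto rules\<close>

text \<open>
  Both rules are stated on the unit interval, with nodes in increasing order and indexed from 1,
  and with exactness degree \<open>2 n - 1\<close>, resp. \<open>2 n - 3\<close>. These conditions determine the nodes
  and weights uniquely; exactness on constants makes the weights sum to 1.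
\<close>

definition gauss_rule :: "nat \<Rightarrow> (nat \<Rightarrow> real) \<Rightarrow> (nat \<Rightarrow> real) \<Rightarrow> bool" where
  "gauss_rule n z w \<longleftrightarrow>
    n \<ge> 1 \<and> strict_mono_on {1..n} z \<and> z ` {1..n} \<subseteq> {0<..<1} \<and>
    (\<forall>f :: real poly. degree f \<le> 2 * n - 1 \<longrightarrow>
      (\<Sum>\<mu>=1..n. w \<mu> * poly f (z \<mu>)) = integral {0..1} (poly f))"

definition gauss_lobatto_rule :: "nat \<Rightarrow> (nat \<Rightarrow> real) \<Rightarrow> (nat \<Rightarrow> real) \<Rightarrow> bool" where
  "gauss_lobatto_rule n z w \<longleftrightarrow>
    n \<ge> 2 \<and> strict_mono_on {1..n} z \<and> z 1 = 0 \<and> z n = 1 \<and>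
    (\<forall>f :: real poly. degree f \<le> 2 * n - 3 \<longrightarrow>
      (\<Sum>\<nu>=1..n. w \<nu> * poly f (z \<nu>)) = integral {0..1} (poly f))"

record quadrature =
  gnum :: nat
  gnode :: "nat \<Rightarrow> real"
  gweight :: "nat \<Rightarrow> real"
  lnum :: nat
  lnode :: "nat \<Rightarrow> real"
  lweight :: "nat \<Rightarrow> real"


section \<open>Overlapping meshes\<close>

text \<open>
  Subscripts are real numbers: the abscissa with subscript \<open>i\<close> is \<open>xorig + i * dx\<close>, primal cells
  have integer and dual cells half-odd-integer subscripts, and \<open>i - 1/4\<close>, \<open>i + 1/4\<close> are the
  subscripts of the midpoints of the two halves of the cell with subscript \<open>i\<close>.

  The primal cells \<open>1 \<le> i \<le> nx\<close>, \<open>1 \<le> j \<le> ny\<close> tile the computational rectangle, and the dual cells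
  \<open>(i + 1/2, j + 1/2)\<close>, \<open>0 \<le> i \<le> nx\<close>, \<open>0 \<le> j \<le> ny\<close>, cover it. Updating the dual cells needs primal data
  in one layer of ghost cells around the rectangle; updating the primal cells needs no further
  dual data.
\<close>

record mesh =
  xorig :: real
  yorig :: real
  dx :: real
  dy :: real
  nx :: nat
  ny :: nat

definition xpos :: "mesh \<Rightarrow> real \<Rightarrow> real" where "xpos M i = xorig M + i * dx M"
definition ypos :: "mesh \<Rightarrow> real \<Rightarrow> real" where "ypos M j = yorig M + j * dy M"

definition primal_ix :: "mesh \<Rightarrow> (real \<times> real) set" where
  "primal_ix M = real ` {1..nx M} \<times> real ` {1..ny M}"

definition primal_ghost_ix :: "mesh \<Rightarrow> (real \<times> real) set" where
  "primal_ghost_ix M = real ` {0..nx M + 1} \<times> real ` {0..ny M + 1}"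

definition dual_ix :: "mesh \<Rightarrow> (real \<times> real) set" where
  "dual_ix M = (\<lambda>i. real i + 1/2) ` {0..nx M} \<times> (\<lambda>j. real j + 1/2) ` {0..ny M}"

definition cell :: "mesh \<Rightarrow> real \<Rightarrow> real \<Rightarrow> (real \<times> real) set" where
  "cell M i j =
    {xpos M (i - 1/2) <..< xpos M (i + 1/2)} \<times> {ypos M (j - 1/2) <..< ypos M (j + 1/2)}"

definition quarter_cell :: "mesh \<Rightarrow> real \<Rightarrow> real \<Rightarrow> (real \<times> real) set" where
  "quarter_cell M c d =
    {xpos M (c - 1/4) <..< xpos M (c + 1/4)} \<times> {ypos M (d - 1/4) <..< ypos M (d + 1/4)}"

type_synonym field2 = "real \<times> real \<Rightarrow> state"

definition polynomial_on :: "nat \<Rightarrow> (real \<times> real) set \<Rightarrow> field2 \<Rightarrow> bool" where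
  "polynomial_on k S U \<longleftrightarrow>
    (\<exists>c :: nat \<Rightarrow> nat \<Rightarrow> state. \<forall>(x, y)\<in>S.
      U (x, y) = (\<Sum>r\<le>k. \<Sum>s\<le>k - r. (x ^ r * y ^ s) *\<^sub>R c r s))"

definition cell_avg :: "mesh \<Rightarrow> field2 \<Rightarrow> real \<Rightarrow> real \<Rightarrow> state" where
  "cell_avg M U i j = (1 / (dx M * dy M)) *\<^sub>R integral (cell M i j) U"

definition trace :: "mesh \<Rightarrow> field2 \<Rightarrow> real \<Rightarrow> real \<Rightarrow> real \<times> real \<Rightarrow> state" where
  "trace M U c d z = Lim (at z within quarter_cell M c d) U"

definition gx :: "mesh \<Rightarrow> quadrature \<Rightarrow> real \<Rightarrow> nat \<Rightarrow> real" where
  "gx M Q c \<mu> = xpos M (c - 1/4) + gnode Q \<mu> * (dx M / 2)"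
definition gy :: "mesh \<Rightarrow> quadrature \<Rightarrow> real \<Rightarrow> nat \<Rightarrow> real" where
  "gy M Q d \<mu> = ypos M (d - 1/4) + gnode Q \<mu> * (dy M / 2)"
definition lx :: "mesh \<Rightarrow> quadrature \<Rightarrow> real \<Rightarrow> nat \<Rightarrow> real" where
  "lx M Q c \<nu> = xpos M (c - 1/4) + lnode Q \<nu> * (dx M / 2)"
definition ly :: "mesh \<Rightarrow> quadrature \<Rightarrow> real \<Rightarrow> nat \<Rightarrow> real" where
  "ly M Q d \<nu> = ypos M (d - 1/4) + lnode Q \<nu> * (dy M / 2)"

definition Qx :: "mesh \<Rightarrow> quadrature \<Rightarrow> real \<Rightarrow> real set" where
  "Qx M Q i = (\<Union>\<sigma>\<in>{-1, 1}. gx M Q (i + \<sigma>/4) ` {1..gnum Q})"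
definition Qy :: "mesh \<Rightarrow> quadrature \<Rightarrow> real \<Rightarrow> real set" where
  "Qy M Q j = (\<Union>\<sigma>\<in>{-1, 1}. gy M Q (j + \<sigma>/4) ` {1..gnum Q})"

text \<open>
  The values of \<open>U\<close> at the points of the tensor-product node set of the cell \<open>(i, j)\<close>. Each node is
  taken together with the quarter cell whose half-intervals supply it, and the value there
  is the limit from within that quarter cell; a node shared by two quarter cells thus
  contributes both limits.
\<close>

definition node_values :: "mesh \<Rightarrow> quadrature \<Rightarrow> field2 \<Rightarrow> real \<Rightarrow> real \<Rightarrow> state set" where
  "node_values M Q U i j =
    (\<Union>\<sigma>\<in>{-1, 1}. \<Union>\<tau>\<in>{-1, 1}.
      trace M U (i + \<sigma>/4) (j + \<tau>/4) `
        (gx M Q (i + \<sigma>/4) ` {1..gnum Q} \<times> ly M Q (j + \<tau>/4) ` {1..lnum Q} \<union>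
         lx M Q (i + \<sigma>/4) ` {1..lnum Q} \<times> gy M Q (j + \<tau>/4) ` {1..gnum Q}))"


section \<open>Central DG scheme\<close>

text \<open>
  Below \<open>U\<close> is the field whose average on the cell \<open>(i, j)\<close> is updated and \<open>W\<close> the field on the
  other mesh. The points at which \<open>W\<close> is evaluated without a limit lie in open cells of the mesh of \<open>W\<close>,
  since Gauss nodes are interior to the half-intervals.
\<close>

definition cdg_rhs ::
    "eos \<Rightarrow> mesh \<Rightarrow> quadrature \<Rightarrow> real \<Rightarrow> field2 \<Rightarrow> field2 \<Rightarrow> real \<Rightarrow> real \<Rightarrow> state" where
  "cdg_rhs p M Q \<tau>max U W i j =
    (1 / \<tau>max) *\<^sub>R (cell_avg M W i j - cell_avg M U i j)
    - (1 / dx M) *\<^sub>R (\<Sum>\<sigma>\<in>{-1, 1}. \<Sum>\<mu>=1..gnum Q. (gweight Q \<mu> / 2) *\<^sub>R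
        (flux p 1 (W (xpos M (i + 1/2), gy M Q (j + \<sigma>/4) \<mu>))
         - flux p 1 (W (xpos M (i - 1/2), gy M Q (j + \<sigma>/4) \<mu>))))
    - (1 / dy M) *\<^sub>R (\<Sum>\<sigma>\<in>{-1, 1}. \<Sum>\<mu>=1..gnum Q. (gweight Q \<mu> / 2) *\<^sub>R
        (flux p 2 (W (gx M Q (i + \<sigma>/4) \<mu>, ypos M (j + 1/2)))
         - flux p 2 (W (gx M Q (i + \<sigma>/4) \<mu>, ypos M (j - 1/2)))))"

definition updated_avg ::
    "eos \<Rightarrow> mesh \<Rightarrow> quadrature \<Rightarrow> real \<Rightarrow> real \<Rightarrow> field2 \<Rightarrow> field2 \<Rightarrow> real \<Rightarrow> real \<Rightarrow> state" where
  "updated_avg p M Q \<tau>max \<Delta>t U W i j =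
    cell_avg M U i j + \<Delta>t *\<^sub>R cdg_rhs p M Q \<tau>max U W i j"

definition discrete_div :: "mesh \<Rightarrow> quadrature \<Rightarrow> field2 \<Rightarrow> real \<Rightarrow> real \<Rightarrow> real" where
  "discrete_div M Q W i j =
    1 / dx M * (\<Sum>\<sigma>\<in>{-1, 1}. \<Sum>\<mu>=1..gnum Q. gweight Q \<mu> / 2 *
        (mag (W (xpos M (i + 1/2), gy M Q (j + \<sigma>/4) \<mu>)) $ 1
         - mag (W (xpos M (i - 1/2), gy M Q (j + \<sigma>/4) \<mu>)) $ 1))
    + 1 / dy M * (\<Sum>\<sigma>\<in>{-1, 1}. \<Sum>\<mu>=1..gnum Q. gweight Q \<mu> / 2 *
        (mag (W (gx M Q (i + \<sigma>/4) \<mu>, ypos M (j + 1/2))) $ 2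
         - mag (W (gx M Q (i + \<sigma>/4) \<mu>, ypos M (j - 1/2))) $ 2))"

definition a_hat1 :: "eos \<Rightarrow> mesh \<Rightarrow> quadrature \<Rightarrow> field2 \<Rightarrow> field2 \<Rightarrow> real" where
  "a_hat1 p M Q UC UD = Max (
    (\<Union>(i, j)\<in>dual_ix M.
      (\<lambda>y. wave_bound p 1 (UC (xpos M (i + 1/2), y)) (UC (xpos M (i - 1/2), y))) ` Qy M Q j) \<union>
    (\<Union>(i, j)\<in>primal_ix M.
      (\<lambda>y. wave_bound p 1 (UD (xpos M (i + 1/2), y)) (UD (xpos M (i - 1/2), y))) ` Qy M Q j))"

definition a_hat2 :: "eos \<Rightarrow> mesh \<Rightarrow> quadrature \<Rightarrow> field2 \<Rightarrow> field2 \<Rightarrow> real" where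
  "a_hat2 p M Q UC UD = Max (
    (\<Union>(i, j)\<in>dual_ix M.
      (\<lambda>x. wave_bound p 2 (UC (x, ypos M (j + 1/2))) (UC (x, ypos M (j - 1/2)))) ` Qx M Q i) \<union>
    (\<Union>(i, j)\<in>primal_ix M.
      (\<lambda>x. wave_bound p 2 (UD (x, ypos M (j + 1/2))) (UD (x, ypos M (j - 1/2)))) ` Qx M Q i))"

text \<open>
  The sign \<open>s\<close>, \<open>-1\<close> or \<open>1\<close>, is the second superscript of the vector \<open>\<Pi>\<close>.
\<close>

definition Pi_vec ::
    "mesh \<Rightarrow> quadrature \<Rightarrow> real \<Rightarrow> real \<Rightarrow> field2 \<Rightarrow> real \<Rightarrow> real \<Rightarrow> nat \<Rightarrow> real \<Rightarrow> state" where
  "Pi_vec M Q lam1 lam2 W i j \<nu> s =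
    (lam1 / (lam1 + lam2)) *\<^sub>R (\<Sum>\<sigma>\<in>{-1, 1}. \<Sum>\<mu>=1..gnum Q. (gweight Q \<mu> / 2) *\<^sub>R
        trace M W (i + s/4) (j + \<sigma>/4) (lx M Q (i + s/4) \<nu>, gy M Q (j + \<sigma>/4) \<mu>))
    + (lam2 / (lam1 + lam2)) *\<^sub>R (\<Sum>\<sigma>\<in>{-1, 1}. \<Sum>\<mu>=1..gnum Q. (gweight Q \<mu> / 2) *\<^sub>R
        trace M W (i + \<sigma>/4) (j + s/4) (gx M Q (i + \<sigma>/4) \<mu>, ly M Q (j + s/4) \<nu>))"

end

theory Submission
  imports Defs
begin

text \<open>
  The identity \<open>U \<bullet> n* + |B*|\<^sup>2/2 = \<rho>|v - v*|\<^sup>2/2 + |B - B*|\<^sup>2/2 + \<E>(U)\<close> turns admissibility into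
  positivity of a family of affine functionals of the state. For two admissible states and
  \<open>\<alpha> \<ge> \<alpha>\<^sub>l(U, V)\<close>, the difference of the fluxes tested with \<open>n*\<close>, up to the terms \<open>B\<^sub>l (v* \<bullet> B*)\<close>
  that make up the discrete divergence, is at most \<open>\<alpha>\<close> times the sum of the two functionals:
  the part quadratic in \<open>\<surd>\<rho> (v - v*)\<close>, \<open>B - B*\<close>, \<open>\<surd>(2\<rho>e)\<close> is controlled by the fast speed, which is
  the larger eigenvalue of a 2x2 matrix, and the remaining dependence on \<open>v*\<close> by the Roe average
  and the jump of \<open>B\<close>. The average of the other field is decomposed by the product of
  Gauss--Lobatto and Gauss rules on the quarter cells; the contributions of the two outer
  Lobatto nodes absorb the fluxes by the CFL condition, the two inner ones are the vectors \<open>\<Pi>\<close>,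
  and all others are positive because the weights are.
\<close>

section \<open>Flux estimate for a pair of admissible states\<close>

text \<open>\<open>r\<close> is the larger eigenvalue of the symmetric matrix with diagonal
  \<open>a\<close>, \<open>d\<close> and off-diagonal entry \<open>q\<close>. Hence
  \<open>r - a\<close> and \<open>r - d\<close> are nonnegative with product
  \<open>q\<^sup>2\<close>, and the claim becomes the arithmetic-geometric mean inequality for
  \<open>sqrt (r - a) * \<bar>x\<bar>\<close> and
  \<open>sqrt (r - d) * \<bar>z\<bar>\<close>.\<close>

lemma quadratic_form_le_larger_eigenvalue:
  fixes a d q r x z :: real
  assumes r: "r = (a + d + sqrt ((a + d)\<^sup>2 - 4 * (a * d - q\<^sup>2))) / 2"
  shows "a * x\<^sup>2 + 2 * q * x * z + d * z\<^sup>2 \<le> r * (x\<^sup>2 + z\<^sup>2)"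
proof -
  define s where "s = sqrt ((a - d)\<^sup>2 + (2 * q)\<^sup>2)"
  have s2: "s\<^sup>2 = (a - d)\<^sup>2 + (2 * q)\<^sup>2"
    by (simp add: s_def)
  have "(a + d)\<^sup>2 - 4 * (a * d - q\<^sup>2) = (a - d)\<^sup>2 + (2 * q)\<^sup>2"
    by (simp add: power2_eq_square algebra_simps)
  then have rs: "r = (a + d + s) / 2"
    using r by (simp add: s_def)
  have "\<bar>a - d\<bar> \<le> s"
    unfolding s_def by (rule real_le_rsqrt) simp
  then have ge: "r - a \<ge> 0" "r - d \<ge> 0"
    using rs by (auto simp: abs_if split: if_splits)
  have prod: "(r - a) * (r - d) = q\<^sup>2"
  proof -
    have "4 * ((r - a) * (r - d)) = s\<^sup>2 - (a - d)\<^sup>2"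
      unfolding rs by (simp add: power2_eq_square field_simps)
    then show ?thesis using s2 by (simp add: power2_eq_square)
  qed
  have "q * x * z \<le> \<bar>q\<bar> * \<bar>x\<bar> * \<bar>z\<bar>"
    by (metis abs_ge_self abs_mult)
  also have "\<bar>q\<bar> = sqrt (r - a) * sqrt (r - d)"
    using prod by (metis real_sqrt_abs real_sqrt_mult)
  finally have "2 * (q * x * z) \<le> 2 * ((sqrt (r - a) * \<bar>x\<bar>) * (sqrt (r - d) * \<bar>z\<bar>))"
    by (simp add: mult_ac)
  also have "\<dots> \<le> (sqrt (r - a) * \<bar>x\<bar>)\<^sup>2 + (sqrt (r - d) * \<bar>z\<bar>)\<^sup>2"
    using sum_squares_bound by (metis mult.assoc)
  also have "\<dots> = (r - a) * x\<^sup>2 + (r - d) * z\<^sup>2"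
    using ge by (simp add: power_mult_distrib)
  finally show ?thesis
    by (simp add: algebra_simps)
qed

text \<open>Split \<open>X\<close> and \<open>B\<close> into their parts along the axis
  \<open>l\<close> and orthogonal to it. The axial parts cancel in the difference, and the triangle
  inequality leaves a quadratic form in \<open>\<bar>X $ l\<bar>\<close> and \<open>norm Y\<close>
  whose matrix has trace \<open>b\<close> and determinant
  \<open>(B $ l)\<^sup>2 * c\<^sup>2\<close>. The factor on the right is its larger
  eigenvalue.\<close>

lemma cross_magnetosonic_bound:
  fixes X B :: vec3 and c :: real
  defines "b \<equiv> (norm B)\<^sup>2 + c\<^sup>2"
  shows "(norm ((X $ l) *\<^sub>R B - (B $ l) *\<^sub>R X))\<^sup>2 + c\<^sup>2 * (X $ l)\<^sup>2
    \<le> (b + sqrt (b\<^sup>2 - 4 * ((B $ l)\<^sup>2 * c\<^sup>2))) / 2 * (norm X)\<^sup>2"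
proof -
  define e :: vec3 where "e = axis l 1"
  define Y where "Y = X - (X $ l) *\<^sub>R e"
  define D where "D = B - (B $ l) *\<^sub>R e"
  have ev: "V \<bullet> e = V $ l" "e \<bullet> V = V $ l" for V :: vec3
    by (simp_all add: e_def inner_axis inner_commute)
  have el: "e $ l = 1" "e \<bullet> e = 1"
    by (simp_all add: e_def inner_axis)
  have X: "(norm X)\<^sup>2 = (X $ l)\<^sup>2 + (norm Y)\<^sup>2"
    unfolding power2_norm_eq_inner Y_def
    by (simp add: inner_diff_left inner_diff_right ev el power2_eq_square)
  have B: "(norm B)\<^sup>2 = (B $ l)\<^sup>2 + (norm D)\<^sup>2"
    unfolding power2_norm_eq_inner D_def
    by (simp add: inner_diff_left inner_diff_right ev el power2_eq_square)
  have "(X $ l) *\<^sub>R B - (B $ l) *\<^sub>R X = (X $ l) *\<^sub>R D - (B $ l) *\<^sub>R Y"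
    by (simp add: Y_def D_def scaleR_diff_right)
  then have n: "norm ((X $ l) *\<^sub>R B - (B $ l) *\<^sub>R X) \<le> \<bar>X $ l\<bar> * norm D + \<bar>B $ l\<bar> * norm Y"
    using norm_triangle_ineq4[of "(X $ l) *\<^sub>R D" "(B $ l) *\<^sub>R Y"] by simp
  define a d q where "a = (norm D)\<^sup>2 + c\<^sup>2" and "d = (B $ l)\<^sup>2" and "q = \<bar>B $ l\<bar> * norm D"
  have ad: "a + d = b" "a * d - q\<^sup>2 = (B $ l)\<^sup>2 * c\<^sup>2"
    by (simp_all add: a_def d_def q_def b_def B power_mult_distrib algebra_simps)
  have "(norm ((X $ l) *\<^sub>R B - (B $ l) *\<^sub>R X))\<^sup>2 + c\<^sup>2 * (X $ l)\<^sup>2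
      \<le> (\<bar>X $ l\<bar> * norm D + \<bar>B $ l\<bar> * norm Y)\<^sup>2 + c\<^sup>2 * (X $ l)\<^sup>2"
    using power_mono[OF n, of 2] by simp
  also have "\<dots> = a * \<bar>X $ l\<bar>\<^sup>2 + 2 * q * \<bar>X $ l\<bar> * norm Y + d * (norm Y)\<^sup>2"
    by (simp add: a_def d_def q_def power2_sum power_mult_distrib algebra_simps)
  also have "\<dots> \<le> (b + sqrt (b\<^sup>2 - 4 * ((B $ l)\<^sup>2 * c\<^sup>2))) / 2 * (\<bar>X $ l\<bar>\<^sup>2 + (norm Y)\<^sup>2)"
    by (rule quadratic_form_le_larger_eigenvalue) (simp add: ad)
  finally show ?thesis
    by (simp add: X)
qed

text \<open>The left side is an inner product of \<open>(b, z)\<close> with a vector of norm at most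
  \<open>f * norm X\<close>, because \<open>f\<^sup>2\<close> is the eigenvalue in
  \<open>cross_magnetosonic_bound\<close>. Cauchy-Schwarz and the arithmetic-geometric mean
  inequality finish the estimate.\<close>

lemma magnetosonic_bilinear_bound:
  fixes X B b :: vec3 and c z f :: real
  defines "t \<equiv> (norm B)\<^sup>2 + c\<^sup>2"
  assumes f: "f = 1 / sqrt 2 * sqrt (t + sqrt (t\<^sup>2 - 4 * ((B $ l)\<^sup>2 * c\<^sup>2)))"
  shows "\<bar>c * X $ l * z + b \<bullet> ((X $ l) *\<^sub>R B - (B $ l) *\<^sub>R X)\<bar>
    \<le> f * (((norm X)\<^sup>2 + (norm b)\<^sup>2 + z\<^sup>2) / 2)"
proof -
  \<comment> \<open>The discriminant is shown nonnegative before \<open>f\<close> is squared, since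
    \<open>sqrt\<close> is negative at negative arguments. It dominates the square of
    \<open>(norm B)\<^sup>2 - c\<^sup>2\<close>.\<close>
  have "(B $ l)\<^sup>2 \<le> (norm B)\<^sup>2"
    using component_le_norm_cart[of B l] abs_le_square_iff by fastforce
  then have "t\<^sup>2 - 4 * ((B $ l)\<^sup>2 * c\<^sup>2) \<ge> ((norm B)\<^sup>2 + c\<^sup>2)\<^sup>2 - 4 * ((norm B)\<^sup>2 * c\<^sup>2)"
    unfolding t_def by (simp add: mult_right_mono)
  moreover have "((norm B)\<^sup>2 + c\<^sup>2)\<^sup>2 - 4 * ((norm B)\<^sup>2 * c\<^sup>2) = ((norm B)\<^sup>2 - c\<^sup>2)\<^sup>2"
    by (simp add: power2_eq_square algebra_simps)
  ultimately have "t\<^sup>2 - 4 * ((B $ l)\<^sup>2 * c\<^sup>2) \<ge> 0"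
    by (metis order_trans zero_le_power2)
  moreover have "t \<ge> 0" by (simp add: t_def)
  ultimately have f2: "f\<^sup>2 = (t + sqrt (t\<^sup>2 - 4 * ((B $ l)\<^sup>2 * c\<^sup>2))) / 2" and f0: "f \<ge> 0"
    by (simp_all add: f power_mult_distrib power_divide)
  define Y where "Y = (X $ l) *\<^sub>R B - (B $ l) *\<^sub>R X"
  have key: "(norm (Y, c * X $ l))\<^sup>2 \<le> (f * norm X)\<^sup>2"
  proof -
    have "(norm (Y, c * X $ l))\<^sup>2 = (norm Y)\<^sup>2 + c\<^sup>2 * (X $ l)\<^sup>2"
      by (simp add: norm_prod_def power_mult_distrib)
    also have "\<dots> \<le> f\<^sup>2 * (norm X)\<^sup>2"
      unfolding f2 unfolding Y_def t_def by (rule cross_magnetosonic_bound)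
    finally show ?thesis by (simp add: power_mult_distrib)
  qed
  have nle: "norm (Y, c * X $ l) \<le> f * norm X"
    using f0 by (intro power2_le_imp_le[OF key]) simp
  have "\<bar>c * X $ l * z + b \<bullet> Y\<bar> = \<bar>(b, z) \<bullet> (Y, c * X $ l)\<bar>"
    by (simp add: algebra_simps)
  also have "\<dots> \<le> norm (b, z) * norm (Y, c * X $ l)"
    by (rule Cauchy_Schwarz_ineq2)
  also have "\<dots> \<le> norm (b, z) * (f * norm X)"
    by (rule mult_left_mono[OF nle]) simp
  also have "\<dots> = f * (norm (b, z) * norm X)" by simp
  also have "\<dots> \<le> f * (((norm (b, z))\<^sup>2 + (norm X)\<^sup>2) / 2)"
    using f0 sum_squares_bound[of "norm (b, z)" "norm X"] by (intro mult_left_mono) auto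
  also have "\<dots> = f * (((norm X)\<^sup>2 + (norm b)\<^sup>2 + z\<^sup>2) / 2)"
    by (simp add: norm_prod_def)
  finally show ?thesis by (simp add: Y_def)
qed

section \<open>Admissible states and the flux tested with \<open>n_one\<close> and
  \<open>n_star\<close>\<close>

lemma admissible_pos:
  assumes "U \<in> admissible"
  shows "rho U > 0" "internal_energy U > 0" "specific_energy U > 0"
  using assms by (auto simp: admissible_def specific_energy_def)

lemma mom_eq_vel: "rho U > 0 \<Longrightarrow> mom U = rho U *\<^sub>R vel U"
  by (simp add: vel_def)

lemma internal_energy_eq_vel:
  assumes "rho U > 0"
  shows "internal_energy U = ener U - rho U * (vel U \<bullet> vel U) / 2 - (mag U \<bullet> mag U) / 2"
  using assms
  by (simp add: internal_energy_def mom_eq_vel power2_norm_eq_inner[symmetric] power_mult_distrib power2_eq_square)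

lemma inner_n_one: "U \<bullet> n_one = rho U"
  by (cases U) (simp add: n_one_def rho_def)

lemma inner_n_star:
  "U \<bullet> n_star vs Bs = rho U * (norm vs)\<^sup>2 / 2 - mom U \<bullet> vs - mag U \<bullet> Bs + ener U"
  by (cases U) (simp add: n_star_def rho_def mom_def mag_def ener_def)

text \<open>Completes the squares in velocity and magnetic field. At \<open>vs = vel U\<close>,
  \<open>Bs = mag U\<close> only \<open>internal_energy U\<close> remains, which is how the energy
  of the update is recovered at the end.\<close>

lemma inner_n_star_eq:
  assumes "rho U > 0"
  shows "U \<bullet> n_star vs Bs + (norm Bs)\<^sup>2 / 2 =
    rho U * (norm (vel U - vs))\<^sup>2 / 2 + (norm (mag U - Bs))\<^sup>2 / 2 + internal_energy U"
  unfolding inner_n_star internal_energy_eq_vel[OF assms] mom_eq_vel[OF assms] power2_norm_eq_inner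
  by (simp add: inner_diff_left inner_diff_right inner_commute algebra_simps
      add_divide_distrib diff_divide_distrib)

lemma inner_n_star_pos:
  assumes "U \<in> admissible"
  shows "U \<bullet> n_star vs Bs + (norm Bs)\<^sup>2 / 2 > 0"
  using admissible_pos[OF assms] by (simp add: inner_n_star_eq add_nonneg_pos)

text \<open>The term with \<open>vs \<bullet> Bs\<close> moved to the left becomes the divergence;
  the one with \<open>(norm Bs)\<^sup>2\<close> is the same for every state and cancels in flux
  differences. On the right, kinetic and internal energy travel with the local velocity, the
  magnetic part with \<open>vs $ l\<close>, and the last bracket is the expression that the fast
  speed controls.\<close>

lemma flux_inner_n_star:
  assumes "rho U > 0"
  shows "flux p l U \<bullet> n_star vs Bs - mag U $ l * (vs \<bullet> Bs) + vs $ l * (norm Bs)\<^sup>2 / 2 =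
    vel U $ l * (rho U * (norm (vel U - vs))\<^sup>2 / 2 + internal_energy U)
    + vs $ l * ((norm (mag U - Bs))\<^sup>2 / 2)
    + (pressure p U * (vel U - vs) $ l
       + (mag U - Bs) \<bullet> (((vel U - vs) $ l) *\<^sub>R mag U - (mag U $ l) *\<^sub>R (vel U - vs)))"
proof -
  define r v B P e c where "r = rho U" and "v = vel U" and "B = mag U" and "P = pressure p U"
    and "e = ener U" and "c = v $ l"
  define w d where "w = vs $ l" and "d = B $ l"
  have ax: "axis l 1 \<bullet> x = x $ l" for x :: vec3
    by (simp add: inner_axis')
  have "flux p l U \<bullet> n_star vs Bs = r * c * (vs \<bullet> vs) / 2
      - (c * (r * (v \<bullet> vs)) - d * (B \<bullet> vs) + (P + (B \<bullet> B) / 2) * w)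
      - (c * (B \<bullet> Bs) - d * (v \<bullet> Bs)) + (c * (e + (P + (B \<bullet> B) / 2)) - d * (v \<bullet> B))"
    by (simp add: flux_def Let_def n_star_def mom_eq_vel[OF assms] power2_norm_eq_inner ax
        inner_diff_left inner_add_left
        r_def v_def B_def P_def e_def c_def w_def d_def)
  then show ?thesis
    unfolding internal_energy_eq_vel[OF assms] power2_norm_eq_inner vector_minus_component
    unfolding r_def[symmetric] v_def[symmetric] B_def[symmetric] P_def[symmetric] e_def[symmetric]
    unfolding c_def[symmetric] w_def[symmetric] d_def[symmetric]
    by (simp add: inner_diff_left inner_diff_right inner_commute algebra_simps
        add_divide_distrib diff_divide_distrib)
qed

lemma flux_inner_n_one: "flux p l U \<bullet> n_one = rho U * vel U $ l"
  by (simp add: flux_def n_one_def Let_def)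

text \<open>Makes the wave speed strictly positive, so that one may divide by it. The inner radicand
  is at least \<open>(g - s)\<^sup>2\<close>, and strictness comes from the sound speed.\<close>

lemma fast_speed_pos:
  assumes "rho U > 0" "sound_speed p U > 0"
  shows "fast_speed p l U > 0"
proof -
  have "(mag U $ l)\<^sup>2 \<le> (norm (mag U))\<^sup>2"
    using component_le_norm_cart[of "mag U" l] abs_le_square_iff by fastforce
  define b where "b = (norm (mag U))\<^sup>2 / rho U + (sound_speed p U)\<^sup>2"
  have b: "b > 0"
    unfolding b_def using assms by (simp add: add_nonneg_pos)
  define g where "g = (norm (mag U))\<^sup>2 / rho U"
  define s where "s = (sound_speed p U)\<^sup>2"
  have "(mag U $ l)\<^sup>2 * s / rho U \<le> g * s"
    unfolding g_def using assms \<open>(mag U $ l)\<^sup>2 \<le> _\<close>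
    by (simp add: field_simps mult_left_mono s_def)
  moreover have "b\<^sup>2 - 4 * (g * s) = (g - s)\<^sup>2"
    unfolding b_def g_def[symmetric] s_def[symmetric] by (simp add: power2_eq_square algebra_simps)
  ultimately have "b\<^sup>2 - 4 * ((mag U $ l)\<^sup>2 * s / rho U) \<ge> 0"
    using zero_le_power2[of "g - s"] by linarith
  then have "b + sqrt (b\<^sup>2 - 4 * ((mag U $ l)\<^sup>2 * s / rho U)) > 0"
    using b by (simp add: add_pos_nonneg)
  then show ?thesis
    by (simp add: fast_speed_def Let_def b_def s_def)
qed

text \<open>Rescaling with \<open>r = sqrt (rho U)\<close>: multiplying \<open>w\<close> by
  \<open>r\<close> and dividing the field by \<open>r\<close> leaves the cross term unchanged and
  turns the energies into plain squares. The pressure term becomes sound speed times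
  \<open>X $ l * z\<close>, which explains the form \<open>p / (rho * sqrt (2 * e))\<close> of the
  sound speed.\<close>

lemma fast_speed_bound:
  assumes U: "U \<in> admissible"
  shows "\<bar>pressure p U * w $ l + b \<bullet> ((w $ l) *\<^sub>R mag U - (mag U $ l) *\<^sub>R w)\<bar>
    \<le> fast_speed p l U * (rho U * (norm w)\<^sup>2 / 2 + (norm b)\<^sup>2 / 2 + internal_energy U)"
proof -
  note pos = admissible_pos[OF U]
  define r where "r = sqrt (rho U)"
  have r: "r > 0" "r\<^sup>2 = rho U" "r * r = rho U" using pos by (simp_all add: r_def)
  define z where "z = sqrt (2 * internal_energy U)"
  have z: "z\<^sup>2 = 2 * internal_energy U" using pos by (simp add: z_def)
  have se: "sqrt (2 * specific_energy U) = z / r"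
    by (simp add: specific_energy_def z_def r_def real_sqrt_divide)
  have zpos: "z > 0" using pos by (simp add: z_def)
  define X B where "X = r *\<^sub>R w" and "B = (1 / r) *\<^sub>R mag U"
  have cs: "sound_speed p U * X $ l * z = pressure p U * w $ l"
    using zpos r(1) unfolding sound_speed_def se r(3)[symmetric] by (simp add: X_def field_simps)
  have cr: "b \<bullet> ((X $ l) *\<^sub>R B - (B $ l) *\<^sub>R X) = b \<bullet> ((w $ l) *\<^sub>R mag U - (mag U $ l) *\<^sub>R w)"
    using r(1) by (simp add: X_def B_def)
  have nB: "(norm B)\<^sup>2 = (norm (mag U))\<^sup>2 / rho U" "(B $ l)\<^sup>2 = (mag U $ l)\<^sup>2 / rho U"
    using r by (simp_all add: B_def power_divide)
  have nX: "(norm X)\<^sup>2 = rho U * (norm w)\<^sup>2"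
    using r by (simp add: X_def power_mult_distrib)
  have "\<bar>sound_speed p U * X $ l * z + b \<bullet> ((X $ l) *\<^sub>R B - (B $ l) *\<^sub>R X)\<bar>
    \<le> fast_speed p l U * (((norm X)\<^sup>2 + (norm b)\<^sup>2 + z\<^sup>2) / 2)"
    by (rule magnetosonic_bilinear_bound) (simp add: nB fast_speed_def Let_def)
  then show ?thesis
    unfolding cs cr nX z by (simp add: add_divide_distrib)
qed

section \<open>Flux difference of two admissible states\<close>

locale admissible_pair =
  fixes p :: eos and l :: 3 and U V :: state and \<alpha> :: real
  assumes eos: "\<And>r e. r > 0 \<Longrightarrow> p r e > 0 \<longleftrightarrow> e > 0"
    and U: "U \<in> admissible" and V: "V \<in> admissible"
    and alpha: "wave_bound p l U V \<le> \<alpha>"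
begin

text \<open>The square root weights make \<open>vs $ l - roe\<close> a combination of
  \<open>sqrt rho * (vel - vs) $ l\<close> over the two states, whose squares are controlled by the
  kinetic parts of the functionals.\<close>

definition "roe = (sqrt (rho U) * vel U $ l + sqrt (rho V) * vel V $ l) / (sqrt (rho U) + sqrt (rho V))"
definition "\<delta> = norm (mag U - mag V) / (sqrt (rho U) + sqrt (rho V))"

lemma fast_pos: "fast_speed p l U > 0" "fast_speed p l V > 0"
proof -
  \<comment> \<open>Only the sign of the pressure is taken from the equation of state.\<close>
  have "sound_speed p W > 0" if "W \<in> admissible" for W
    using admissible_pos[OF that] eos by (simp add: sound_speed_def pressure_def)
  then show "fast_speed p l U > 0" "fast_speed p l V > 0"
    using U V admissible_pos fast_speed_pos by blast+
qed

lemma sqrt_pos: "sqrt (rho U) > 0" "sqrt (rho V) > 0"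
  using admissible_pos U V by auto

lemma delta_nonneg: "\<delta> \<ge> 0"
  using sqrt_pos by (simp add: \<delta>_def)

lemma alpha_ge:
  "\<bar>vel U $ l\<bar> + fast_speed p l U + \<delta> \<le> \<alpha>"
  "\<bar>vel V $ l\<bar> + fast_speed p l V + \<delta> \<le> \<alpha>"
  "\<bar>roe\<bar> + fast_speed p l U + \<delta> \<le> \<alpha>"
  "\<bar>roe\<bar> + fast_speed p l V + \<delta> \<le> \<alpha>"
proof -
  have r: "\<bar>roe\<bar> = \<bar>sqrt (rho U) * vel U $ l + sqrt (rho V) * vel V $ l\<bar> / (sqrt (rho U) + sqrt (rho V))"
    using sqrt_pos by (simp add: roe_def)
  have "Max {\<bar>vel U $ l\<bar> + fast_speed p l U, \<bar>vel V $ l\<bar> + fast_speed p l V,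
      \<bar>roe\<bar> + max (fast_speed p l U) (fast_speed p l V)} + \<delta> \<le> \<alpha>"
    using alpha by (simp only: wave_bound_def r \<delta>_def)
  then show "\<bar>vel U $ l\<bar> + fast_speed p l U + \<delta> \<le> \<alpha>"
    "\<bar>vel V $ l\<bar> + fast_speed p l V + \<delta> \<le> \<alpha>"
    "\<bar>roe\<bar> + fast_speed p l U + \<delta> \<le> \<alpha>"
    "\<bar>roe\<bar> + fast_speed p l V + \<delta> \<le> \<alpha>"
    by simp_all linarith+
qed

lemma alpha_pos: "\<alpha> > 0"
  using alpha_ge(1) fast_pos(1) delta_nonneg by linarith

text \<open>The mass flux is density times velocity, and \<alpha> dominates the velocities. The
  divided shape matches \<open>flux_n_star_nonneg\<close>, so that both estimates feed the same cell
  argument.\<close>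

lemma flux_n_one_nonneg:
  "(U + V) \<bullet> n_one - (flux p l U - flux p l V) \<bullet> n_one / \<alpha> \<ge> 0"
proof -
  have "rho U * vel U $ l \<le> rho U * \<alpha>"
    using alpha_ge(1) fast_pos(1) delta_nonneg admissible_pos[OF U] by (intro mult_left_mono) auto
  moreover have "rho V * (- vel V $ l) \<le> rho V * \<alpha>"
    using alpha_ge(2) fast_pos(2) delta_nonneg admissible_pos[OF V] by (intro mult_left_mono) auto
  ultimately show ?thesis
    unfolding inner_add_left inner_diff_left unfolding flux_inner_n_one unfolding inner_n_one
    using alpha_pos by (simp add: field_simps)
qed

text \<open>Once \<open>vs $ l\<close> is replaced by \<open>roe\<close>, kinetic and internal
  energy \<open>a\<close> carry the local velocity and magnetic energy \<open>b\<close> carries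
  \<open>roe\<close>. Both speeds are at most \<open>c\<close>, the fast speed bounds the bracket
  \<open>K\<close> by its multiple of \<open>a + b\<close>, and \<open>c\<close> plus the fast speed
  is \<open>\<alpha> - \<delta>\<close>.\<close>

lemma one_state_bound:
  assumes W: "W \<in> admissible"
    and m: "\<bar>vel W $ l\<bar> + fast_speed p l W + \<delta> \<le> \<alpha>" "\<bar>roe\<bar> + fast_speed p l W + \<delta> \<le> \<alpha>"
  shows "\<bar>vel W $ l * (rho W * (norm (vel W - vs))\<^sup>2 / 2 + internal_energy W)
      + roe * ((norm (mag W - Bs))\<^sup>2 / 2)
      + (pressure p W * (vel W - vs) $ l
       + (mag W - Bs) \<bullet> (((vel W - vs) $ l) *\<^sub>R mag W - (mag W $ l) *\<^sub>R (vel W - vs)))\<bar>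
    \<le> (\<alpha> - \<delta>) * (W \<bullet> n_star vs Bs + (norm Bs)\<^sup>2 / 2)"
proof -
  note pos = admissible_pos[OF W]
  define a b where "a = rho W * (norm (vel W - vs))\<^sup>2 / 2 + internal_energy W"
    and "b = (norm (mag W - Bs))\<^sup>2 / 2"
  define c where "c = \<alpha> - \<delta> - fast_speed p l W"
  define K where "K = pressure p W * (vel W - vs) $ l
       + (mag W - Bs) \<bullet> (((vel W - vs) $ l) *\<^sub>R mag W - (mag W $ l) *\<^sub>R (vel W - vs))"
  have ab: "a \<ge> 0" "b \<ge> 0" using pos by (simp_all add: a_def b_def)
  have "\<bar>vel W $ l * a\<bar> \<le> c * a"
    unfolding abs_mult using ab m(1) by (simp add: c_def mult_right_mono)
  moreover have "\<bar>roe * b\<bar> \<le> c * b"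
    unfolding abs_mult using ab m(2) by (simp add: c_def mult_right_mono)
  moreover have "\<bar>K\<bar> \<le> fast_speed p l W * (a + b)"
    using fast_speed_bound[OF W, of p "vel W - vs" l "mag W - Bs"]
    by (simp add: K_def a_def b_def add_ac)
  moreover have S: "W \<bullet> n_star vs Bs + (norm Bs)\<^sup>2 / 2 = a + b"
    using pos by (simp add: inner_n_star_eq a_def b_def)
  moreover have "(\<alpha> - \<delta>) * (a + b) = c * a + c * b + fast_speed p l W * (a + b)"
    by (simp add: c_def algebra_simps)
  ultimately show ?thesis
    unfolding a_def[symmetric] b_def[symmetric] K_def[symmetric] S
    by linarith
qed

text \<open>
  The only term without a bound by the local wave speed is \<open>vs $ l\<close> times the difference of the
  magnetic energies; \<open>vs $ l\<close> is replaced by the Roe average of the velocities, and the remainder,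
  which carries the factor \<open>mag U - mag V\<close>, is absorbed by \<open>\<delta>\<close>.
\<close>

lemma roe_remainder:
  "\<bar>(vs $ l - roe) * ((norm (mag U - Bs))\<^sup>2 / 2 - (norm (mag V - Bs))\<^sup>2 / 2)\<bar>
    \<le> \<delta> * ((U \<bullet> n_star vs Bs + (norm Bs)\<^sup>2 / 2) + (V \<bullet> n_star vs Bs + (norm Bs)\<^sup>2 / 2))"
proof -
  note pos = admissible_pos[OF U] admissible_pos[OF V]
  define r s where "r = sqrt (rho U)" and "s = sqrt (rho V)"
  have rs: "r > 0" "s > 0" "r\<^sup>2 = rho U" "s\<^sup>2 = rho V" using pos by (simp_all add: r_def s_def)
  define w x where "w = vel U - vs" and "x = vel V - vs"
  define b c where "b = mag U - Bs" and "c = mag V - Bs"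
  define g where "g = r * w $ l + s * x $ l"
  have g: "vs $ l - roe = - g / (r + s)"
  proof -
    have "roe = (r * vel U $ l + s * vel V $ l) / (r + s)"
      by (simp add: roe_def r_def s_def)
    moreover have "r + s > 0" using rs by simp
    ultimately show ?thesis
      by (simp add: g_def w_def x_def divide_simps) (simp add: algebra_simps)
  qed
  \<comment> \<open>Factoring the difference of squares isolates
    \<open>b - c = mag U - mag V\<close>, the numerator of \<delta>; what is left is split evenly
    between the factors \<open>g\<close> and \<open>b + c\<close>.\<close>
  have "(norm b)\<^sup>2 - (norm c)\<^sup>2 = (b - c) \<bullet> (b + c)"
    by (simp add: power2_norm_eq_inner inner_diff_left inner_add_right inner_diff_right inner_commute)
  then have n: "\<bar>(norm b)\<^sup>2 - (norm c)\<^sup>2\<bar> \<le> norm (b - c) * norm (b + c)"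
    using Cauchy_Schwarz_ineq2 by metis
  have sq: "(u + v)\<^sup>2 \<le> 2 * (u\<^sup>2 + v\<^sup>2)" for u v :: real
    using sum_squares_bound[of u v] by (simp add: power2_sum)
  have "\<bar>g\<bar> \<le> r * norm w + s * norm x"
    using component_le_norm_cart[of w l] component_le_norm_cart[of x l] rs
    unfolding g_def
    by (intro order_trans[OF abs_triangle_ineq] add_mono) (simp_all add: abs_mult)
  from power_mono[OF this, of 2]
  have g2: "\<bar>g\<bar>\<^sup>2 \<le> 2 * (rho U * (norm w)\<^sup>2 + rho V * (norm x)\<^sup>2)"
    using sq[of "r * norm w" "s * norm x"] rs by (simp add: power_mult_distrib)
  have b2: "(norm (b + c))\<^sup>2 \<le> 2 * ((norm b)\<^sup>2 + (norm c)\<^sup>2)"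
    by (rule order_trans[OF power_mono[OF norm_triangle_ineq] sq]) simp
  have "\<bar>g\<bar> * norm (b + c) / 2 \<le> (\<bar>g\<bar>\<^sup>2 + (norm (b + c))\<^sup>2) / 4"
    using sum_squares_bound[of "\<bar>g\<bar>" "norm (b + c)"] by simp
  also have "\<dots> \<le> (rho U * (norm w)\<^sup>2 + rho V * (norm x)\<^sup>2) / 2 + ((norm b)\<^sup>2 + (norm c)\<^sup>2) / 2"
    using g2 b2 by (simp add: add_divide_distrib)
  also have "\<dots> \<le> (U \<bullet> n_star vs Bs + (norm Bs)\<^sup>2 / 2) + (V \<bullet> n_star vs Bs + (norm Bs)\<^sup>2 / 2)"
    using pos by (simp add: inner_n_star_eq b_def c_def w_def x_def add_divide_distrib)
  finally have fin: "\<bar>g\<bar> * norm (b + c) / 2 \<le> \<dots>" .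
  have "\<bar>(vs $ l - roe) * ((norm b)\<^sup>2 / 2 - (norm c)\<^sup>2 / 2)\<bar>
      = \<bar>g\<bar> / (r + s) * (\<bar>(norm b)\<^sup>2 - (norm c)\<^sup>2\<bar> / 2)"
    using rs by (simp add: g abs_mult flip: diff_divide_distrib)
  also have "\<dots> \<le> \<bar>g\<bar> / (r + s) * (norm (b - c) * norm (b + c) / 2)"
    using n rs by (intro mult_left_mono) auto
  also have "\<dots> = norm (b - c) / (r + s) * (\<bar>g\<bar> * norm (b + c) / 2)"
    by simp
  also have "norm (b - c) / (r + s) = \<delta>"
    by (simp add: \<delta>_def b_def c_def r_def s_def)
  finally show ?thesis
    unfolding b_def[symmetric] c_def[symmetric]
    using mult_left_mono[OF fin delta_nonneg] by linarith
qed

text \<open>Writing \<open>vs $ l\<close> as \<open>roe\<close> plus a remainder splits the budget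
  \<alpha>: each state consumes \<open>\<alpha> - \<delta>\<close> of its functional by
  \<open>one_state_bound\<close>, and \<open>roe_remainder\<close> consumes the missing
  \<delta>.\<close>

lemma flux_n_star_nonneg:
  "(U + V) \<bullet> n_star vs Bs + (norm Bs)\<^sup>2
    - ((flux p l U - flux p l V) \<bullet> n_star vs Bs - (mag U - mag V) $ l * (vs \<bullet> Bs)) / \<alpha> \<ge> 0"
proof -
  note pos = admissible_pos[OF U] admissible_pos[OF V]
  define S where "S W = W \<bullet> n_star vs Bs + (norm Bs)\<^sup>2 / 2" for W
  define R where "R W = vel W $ l * (rho W * (norm (vel W - vs))\<^sup>2 / 2 + internal_energy W)" for W
  define K where "K W = pressure p W * (vel W - vs) $ l
       + (mag W - Bs) \<bullet> (((vel W - vs) $ l) *\<^sub>R mag W - (mag W $ l) *\<^sub>R (vel W - vs))" for W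
  define b where "b W = (norm (mag W - Bs))\<^sup>2 / 2" for W
  have "(flux p l U - flux p l V) \<bullet> n_star vs Bs - (mag U - mag V) $ l * (vs \<bullet> Bs)
      = (R U + roe * b U + K U) - (R V + roe * b V + K V) + (vs $ l - roe) * (b U - b V)"
  proof -
    have F: "flux p l W \<bullet> n_star vs Bs = R W + vs $ l * b W + K W + mag W $ l * (vs \<bullet> Bs)
        - vs $ l * (norm Bs)\<^sup>2 / 2" if "rho W > 0" for W
      using flux_inner_n_star[OF that, of p l vs Bs] unfolding R_def K_def b_def by linarith
    show ?thesis
      unfolding inner_diff_left F[OF pos(1)] F[OF pos(4)] by (simp add: algebra_simps)
  qed
  moreover have "\<bar>R U + roe * b U + K U\<bar> \<le> (\<alpha> - \<delta>) * S U"
    unfolding R_def b_def K_def S_def using U alpha_ge by (intro one_state_bound)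
  moreover have "\<bar>R V + roe * b V + K V\<bar> \<le> (\<alpha> - \<delta>) * S V"
    unfolding R_def b_def K_def S_def using V alpha_ge by (intro one_state_bound)
  moreover have "\<bar>(vs $ l - roe) * (b U - b V)\<bar> \<le> \<delta> * (S U + S V)"
    unfolding b_def S_def by (rule roe_remainder)
  ultimately have "(flux p l U - flux p l V) \<bullet> n_star vs Bs - (mag U - mag V) $ l * (vs \<bullet> Bs)
      \<le> (\<alpha> - \<delta>) * S U + (\<alpha> - \<delta>) * S V + \<delta> * (S U + S V)"
    by linarith
  also have "\<dots> = \<alpha> * (S U + S V)"
    by (simp add: algebra_simps)
  finally have "(flux p l U - flux p l V) \<bullet> n_star vs Bs - (mag U - mag V) $ l * (vs \<bullet> Bs)
      \<le> \<alpha> * (S U + S V)" .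
  then have "((flux p l U - flux p l V) \<bullet> n_star vs Bs - (mag U - mag V) $ l * (vs \<bullet> Bs)) / \<alpha>
      \<le> S U + S V"
    using alpha_pos by (simp add: pos_divide_le_eq mult.commute)
  then show ?thesis
    by (simp add: S_def inner_add_left)
qed

end

section \<open>Weights of the Gauss and Gauss--Lobatto rules\<close>

lemma continuous_on_poly_id: "continuous_on S (poly f)" for f :: "real poly"
  using continuous_on_poly[OF continuous_on_id, of S f] by simp

lemma poly_integrable: "poly f integrable_on {a..b}" for f :: "real poly"
  by (rule integrable_continuous_real[OF continuous_on_poly_id])

text \<open>A nonnegative integrand with zero integral would vanish on all of \<open>{0..1}\<close>,
  giving a nonzero polynomial infinitely many roots.\<close>

lemma integral_poly_pos:
  fixes f :: "real poly"
  assumes "f \<noteq> 0" and "\<And>x. x \<in> {0..1} \<Longrightarrow> poly f x \<ge> 0"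
  shows "integral {0..1} (poly f) > 0"
proof -
  have "integral {0..1} (poly f) \<ge> 0"
    by (rule integral_nonneg[OF poly_integrable]) (use assms in auto)
  moreover have "integral {0..1} (poly f) \<noteq> 0"
  proof
    assume 0: "integral {0..1} (poly f) = 0"
    have "poly f x = 0" if "x \<in> {0..1}" for x
      using integral_eq_0_iff[of 0 1 "poly f", OF continuous_on_poly_id] assms(2) that 0 by simp
    then have "{0..1} \<subseteq> {x. poly f x = 0}"
      by blast
    then have "finite {0..1::real}"
      using poly_roots_finite[OF assms(1)] by (rule finite_subset)
    then show False
      using infinite_Icc[of 0 "1::real"] by simp
  qed
  ultimately show ?thesis by linarith
qed

text \<open>Lets the two end weights of the Lobatto rule be compared without first proving its nodes
  symmetric.\<close>

lemma integral_poly_reflect: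
  fixes f :: "real poly"
  shows "integral {0..1} (poly (f \<circ>\<^sub>p [:1, -1:])) = integral {0..1} (poly f)"
proof -
  have int: "(poly f has_integral integral {0..1} (poly f)) (cbox 0 1)"
    unfolding cbox_interval
    by (rule integrable_integral[OF poly_integrable])
  have "((\<lambda>x. poly f (-1 *\<^sub>R x + 1)) has_integral (1 / \<bar>-1\<bar> ^ DIM(real)) *\<^sub>R integral {0..1} (poly f))
      ((\<lambda>x. (1 / -1) *\<^sub>R x + - ((1 / -1) *\<^sub>R 1)) ` cbox 0 1)"
    by (rule has_integral_affinity[OF int]) simp
  moreover have "(\<lambda>x::real. (1 / -1) *\<^sub>R x + - ((1 / -1) *\<^sub>R 1)) = (\<lambda>x. 1 - x)"
    by (simp add: fun_eq_iff)
  moreover have "(\<lambda>x::real. 1 - x) ` cbox 0 1 = {0..1}"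
    by (simp add: cbox_interval)
  ultimately have "((\<lambda>x. poly f (1 - x)) has_integral integral {0..1} (poly f)) {0..1}"
    by simp
  moreover have "poly (f \<circ>\<^sub>p [:1, -1:]) = (\<lambda>x. poly f (1 - x))"
    by (simp add: fun_eq_iff poly_pcompose)
  ultimately show ?thesis
    by (metis integral_unique)
qed

definition node_poly :: "(nat \<Rightarrow> real) \<Rightarrow> nat set \<Rightarrow> real poly" where
  "node_poly z A = (\<Prod>\<nu>\<in>A. [:- z \<nu>, 1:])"

lemma poly_node_poly: "poly (node_poly z A) x = (\<Prod>\<nu>\<in>A. x - z \<nu>)"
  by (simp add: node_poly_def poly_prod)

lemma degree_node_poly: "finite A \<Longrightarrow> degree (node_poly z A) = card A"
  unfolding node_poly_def by (subst degree_prod_sum_eq) auto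

lemma poly_node_poly_eq_0_iff:
  assumes "strict_mono_on {1..n} z" "A \<subseteq> {1..n}" "\<nu> \<in> {1..n}"
  shows "poly (node_poly z A) (z \<nu>) = 0 \<longleftrightarrow> \<nu> \<in> A"
proof -
  have "inj_on z {1..n}" using assms(1) by (rule strict_mono_on_imp_inj_on)
  moreover have "finite A" using assms(2) finite_subset by blast
  ultimately show ?thesis
    using assms(2,3) by (auto simp: poly_node_poly dest: inj_onD)
qed

text \<open>A nonnegative test polynomial vanishing at every other node reduces the rule to a single
  term, which must equal a positive integral.\<close>

lemma quadrature_weight_pos:
  fixes z w :: "nat \<Rightarrow> real" and f :: "real poly"
  assumes ex: "(\<Sum>\<nu>=1..n. w \<nu> * poly f (z \<nu>)) = integral {0..1} (poly f)"
    and m: "m \<in> {1..n}" and f: "\<And>x. x \<in> {0..1} \<Longrightarrow> poly f x \<ge> 0"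
    and z: "\<And>\<nu>. \<nu> \<in> {1..n} - {m} \<Longrightarrow> poly f (z \<nu>) = 0"
    and nz: "poly f (z m) \<noteq> 0" and zm: "z m \<in> {0..1}"
  shows "w m > 0"
proof -
  have "(\<Sum>\<nu>=1..n. w \<nu> * poly f (z \<nu>)) = (\<Sum>\<nu>\<in>{m}. w \<nu> * poly f (z \<nu>))"
    by (rule sum.mono_neutral_right) (use m z in auto)
  then have "w m * poly f (z m) = integral {0..1} (poly f)" using ex by simp
  also have "\<dots> > 0" using nz by (intro integral_poly_pos f) auto
  finally show ?thesis
    using f[OF zm] nz by (simp add: zero_less_mult_iff)
qed

text \<open>The test polynomial is the square of the product over the other nodes; its degree
  \<open>2 * n - 2\<close> is within the exactness.\<close>

lemma gauss_weight_pos: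
  assumes g: "gauss_rule n z w" and m: "m \<in> {1..n}"
  shows "w m > 0"
proof -
  define q where "q = node_poly z ({1..n} - {m})"
  have mono: "strict_mono_on {1..n} z" and z01: "z ` {1..n} \<subseteq> {0<..<1}"
    using g by (auto simp: gauss_rule_def)
  have deg: "degree q = n - 1" using m by (simp add: q_def degree_node_poly)
  have "degree (q\<^sup>2) \<le> 2 * n - 1"
    using degree_power_le[of q 2] deg by simp
  then have "(\<Sum>\<nu>=1..n. w \<nu> * poly (q\<^sup>2) (z \<nu>)) = integral {0..1} (poly (q\<^sup>2))"
    using g unfolding gauss_rule_def by blast
  then show ?thesis
  proof (rule quadrature_weight_pos[OF _ m])
    show "poly (q\<^sup>2) (z \<nu>) = 0" if "\<nu> \<in> {1..n} - {m}" for \<nu>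
      using poly_node_poly_eq_0_iff[OF mono, of "{1..n} - {m}" \<nu>] that by (simp add: q_def poly_power)
    show "poly (q\<^sup>2) (z m) \<noteq> 0"
      using poly_node_poly_eq_0_iff[OF mono, of "{1..n} - {m}" m] m by (simp add: q_def poly_power)
    show "z m \<in> {0..1}" using z01 m by fastforce
  qed (simp add: poly_power)
qed

lemma gauss_weight_sum:
  assumes "gauss_rule n z w"
  shows "(\<Sum>\<mu>=1..n. w \<mu>) = 1"
proof -
  have "(\<Sum>\<mu>=1..n. w \<mu> * poly 1 (z \<mu>)) = integral {0..1} (poly 1)"
    using assms unfolding gauss_rule_def by (elim conjE allE[of _ 1] mp) simp
  moreover have "poly (1 :: real poly) = (\<lambda>_. 1)" by (simp add: fun_eq_iff)
  ultimately show ?thesis by simp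
qed

lemma lobatto_weight_sum:
  assumes "gauss_lobatto_rule n z w"
  shows "(\<Sum>\<nu>=1..n. w \<nu>) = 1"
proof -
  have "(\<Sum>\<nu>=1..n. w \<nu> * poly 1 (z \<nu>)) = integral {0..1} (poly 1)"
    using assms unfolding gauss_lobatto_rule_def by (elim conjE allE[of _ 1] mp) simp
  moreover have "poly (1 :: real poly) = (\<lambda>_. 1)" by (simp add: fun_eq_iff)
  ultimately show ?thesis by simp
qed

section \<open>Positivity and symmetry of the Lobatto weights\<close>

context
  fixes n :: nat and z w :: "nat \<Rightarrow> real"
  assumes lob: "gauss_lobatto_rule n z w"
begin

lemma lobatto_facts:
  shows "n \<ge> 2" "strict_mono_on {1..n} z" "z 1 = 0" "z n = 1"
    and lobatto_exact: "\<And>f. degree f \<le> 2 * n - 3 \<Longrightarrow>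
      (\<Sum>\<nu>=1..n. w \<nu> * poly f (z \<nu>)) = integral {0..1} (poly f)"
  using lob by (auto simp: gauss_lobatto_rule_def)

lemma lobatto_node_interior:
  assumes "\<nu> \<in> {2..n-1}"
  shows "0 < z \<nu>" "z \<nu> < 1"
  using strict_mono_onD[OF lobatto_facts(2), of 1 \<nu>] strict_mono_onD[OF lobatto_facts(2), of \<nu> n]
    lobatto_facts assms by auto

lemma lobatto_node_range:
  assumes "\<nu> \<in> {1..n}"
  shows "z \<nu> \<in> {0..1}"
proof -
  have "\<nu> = 1 \<or> \<nu> = n \<or> \<nu> \<in> {2..n-1}" using assms by auto
  then show ?thesis using lobatto_node_interior[of \<nu>] lobatto_facts by auto
qed

text \<open>Up to a factor this is the Jacobi polynomial for the weight x (1 - x); the argument uses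
  only its degree, its roots and its nonvanishing at the two ends.\<close>

definition "inner_poly = node_poly z {2..n-1}"

lemma inner_poly:
  shows "degree inner_poly = n - 2"
    and "\<nu> \<in> {2..n-1} \<Longrightarrow> poly inner_poly (z \<nu>) = 0"
    and "poly inner_poly 0 \<noteq> 0" "poly inner_poly 1 \<noteq> 0"
proof -
  have A: "{2..n-1} \<subseteq> {1..n}" by auto
  show "degree inner_poly = n - 2"
    by (simp add: inner_poly_def degree_node_poly)
  show "\<nu> \<in> {2..n-1} \<Longrightarrow> poly inner_poly (z \<nu>) = 0"
    using poly_node_poly_eq_0_iff[OF lobatto_facts(2) A, of \<nu>] A unfolding inner_poly_def by auto
  show "poly inner_poly 0 \<noteq> 0"
    using poly_node_poly_eq_0_iff[OF lobatto_facts(2) A, of 1] lobatto_facts unfolding inner_poly_def by auto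
  show "poly inner_poly 1 \<noteq> 0"
    using poly_node_poly_eq_0_iff[OF lobatto_facts(2) A, of n] lobatto_facts unfolding inner_poly_def by auto
qed

lemma lobatto_weight_pos:
  assumes m: "m \<in> {1..n}"
  shows "w m > 0"
proof -
  have mono: "strict_mono_on {1..n} z" using lobatto_facts by auto
  have cases: "\<nu> = 1 \<or> \<nu> = n \<or> \<nu> \<in> {2..n-1}" if "\<nu> \<in> {1..n}" for \<nu>
    using that by auto
  define q where "q = node_poly z ({2..n-1} - {m})"
  \<comment> \<open>The square \<open>q\<^sup>2\<close> removes the other interior nodes, and
    \<open>h\<close> removes the end nodes different from \<open>m\<close> while staying nonnegative
    on the interval. The square at the ends would cost one degree too many.\<close>
  define h :: "real poly" where
    "h = (if m = 1 then [:1, -1:] else if m = n then [:0, 1:] else [:0, 1:] * [:1, -1:])"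
  have h0: "poly h x \<ge> 0" if "x \<in> {0..1}" for x
    using that by (auto simp: h_def)
  have "degree (h * q\<^sup>2) \<le> degree h + 2 * degree q"
    using degree_mult_le[of h "q\<^sup>2"] degree_power_le[of q 2] by simp
  also have "\<dots> \<le> 2 * n - 3"
  proof (cases "m = 1 \<or> m = n")
    case True
    then have "{2..n-1} - {m} = {2..n-1}" using lobatto_facts(1) by auto
    then have "degree q = n - 2" by (simp add: q_def degree_node_poly)
    moreover have "degree h \<le> 1" using True by (auto simp: h_def)
    ultimately show ?thesis using lobatto_facts(1) by simp
  next
    case False
    then have mi: "m \<in> {2..n-1}" using m by auto
    then have "degree q = n - 3" by (simp add: q_def degree_node_poly)
    moreover have "degree h \<le> 2" using False by (simp add: h_def)
    ultimately show ?thesis using mi by auto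
  qed
  finally have "(\<Sum>\<nu>=1..n. w \<nu> * poly (h * q\<^sup>2) (z \<nu>)) = integral {0..1} (poly (h * q\<^sup>2))"
    by (rule lobatto_exact)
  then show ?thesis
  proof (rule quadrature_weight_pos[OF _ m])
    have sub: "{2..n-1} - {m} \<subseteq> {1..n}" by auto
    note q0 = poly_node_poly_eq_0_iff[OF mono sub, folded q_def]
    have h00: "poly h (z \<nu>) = 0 \<longleftrightarrow> \<nu> \<noteq> m \<and> (\<nu> = 1 \<or> \<nu> = n)" if nu: "\<nu> \<in> {1..n}" for \<nu>
    proof -
      have "z \<nu> = 0 \<longleftrightarrow> \<nu> = 1" "z \<nu> = 1 \<longleftrightarrow> \<nu> = n"
        using cases[OF nu] lobatto_facts lobatto_node_interior[of \<nu>] by auto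
      then show ?thesis using lobatto_facts(1) m nu by (auto simp: h_def)
    qed
    show "poly (h * q\<^sup>2) (z \<nu>) = 0" if "\<nu> \<in> {1..n} - {m}" for \<nu>
      using q0[of \<nu>] h00[of \<nu>] that by (auto simp: poly_power)
    show "poly (h * q\<^sup>2) (z m) \<noteq> 0"
      using q0[of m] h00[of m] m by (simp add: poly_power)
    show "z m \<in> {0..1}" by (rule lobatto_node_range[OF m])
  qed (use h0 in \<open>simp add: poly_power\<close>)
qed

lemma lobatto_sum_ends:
  "(\<Sum>\<nu>=1..n. f \<nu>) = f 1 + (\<Sum>\<nu>=2..n-1. f \<nu>) + f n" for f :: "nat \<Rightarrow> 'b::comm_monoid_add"
proof -
  have "{1..n} = insert 1 (insert n {2..n-1})" using lobatto_facts(1) by auto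
  then show ?thesis using lobatto_facts(1) by (simp add: add_ac)
qed

text \<open>
  Among polynomials \<open>g\<close> of degree at most \<open>n - 2\<close>, the integral of \<open>(1 - x) (g x)\<^sup>2\<close> is at least
  \<open>w 1 * (g 0)\<^sup>2\<close>, and reflecting \<open>inner_poly\<close> gives a \<open>g\<close> for which it equals \<open>w n * (g 0)\<^sup>2\<close>;
  likewise at the other end.
\<close>

lemma lobatto_end_weights_eq: "w n = w 1"
proof -
  define q r where "q = inner_poly" and "r = inner_poly \<circ>\<^sub>p [:1, -1:]"
  define a b where "a = [:0, 1:] * q\<^sup>2" and "b = [:1, -1:] * q\<^sup>2"
  have pr: "poly r x = poly q (1 - x)" for x
    by (simp add: r_def q_def poly_pcompose)
  have refl: "a \<circ>\<^sub>p [:1, -1:] = [:1, -1:] * r\<^sup>2" "b \<circ>\<^sub>p [:1, -1:] = [:0, 1:] * r\<^sup>2"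
    unfolding poly_eq_poly_eq_iff[symmetric]
    by (auto simp: fun_eq_iff a_def b_def poly_pcompose pr poly_power algebra_simps)
  have dr: "degree r = n - 2"
    using inner_poly(1) by (simp add: r_def degree_pcompose)
  have dg: "degree ([:c, d:] * s\<^sup>2) \<le> 2 * n - 3" if "degree s = n - 2" for c d and s :: "real poly"
  proof -
    have "degree ([:c, d:] * s\<^sup>2) \<le> degree [:c, d:] + 2 * degree s"
      using degree_mult_le[of "[:c, d:]" "s\<^sup>2"] degree_power_le[of s 2] by simp
    also have "degree [:c, d:] \<le> 1" by simp
    finally show ?thesis using that lobatto_facts(1) by simp
  qed
  have q: "degree q = n - 2" "\<nu> \<in> {2..n-1} \<Longrightarrow> poly q (z \<nu>) = 0" "poly q 0 \<noteq> 0" "poly q 1 \<noteq> 0" for \<nu>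
    using inner_poly by (auto simp: q_def)
  \<comment> \<open>\<open>a\<close> vanishes at every node but the last, so the rule isolates
    \<open>w n\<close>. For the reflected integrand the last node contributes nothing, the interior
    ones are nonnegative, and the first gives \<open>w 1\<close> because \<open>r\<close> at 0 is
    \<open>q\<close> at 1. The second chain swaps the ends.\<close>
  have "w n * (poly q 1)\<^sup>2 = (\<Sum>\<nu>=1..n. w \<nu> * poly a (z \<nu>))"
    unfolding lobatto_sum_ends using q(2) lobatto_facts(3,4) by (simp add: a_def poly_power)
  also have "\<dots> = integral {0..1} (poly a)"
    unfolding a_def by (rule lobatto_exact[OF dg[OF q(1)]])
  also have "\<dots> = integral {0..1} (poly ([:1, -1:] * r\<^sup>2))"
    using integral_poly_reflect[of a] refl by simp
  also have "\<dots> = (\<Sum>\<nu>=1..n. w \<nu> * poly ([:1, -1:] * r\<^sup>2) (z \<nu>))"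
    by (rule lobatto_exact[OF dg[OF dr], symmetric])
  also have "\<dots> \<ge> w 1 * (poly q 1)\<^sup>2"
  proof -
    have "(\<Sum>\<nu>=2..n-1. w \<nu> * poly ([:1, -1:] * r\<^sup>2) (z \<nu>)) \<ge> 0"
    proof (rule sum_nonneg)
      fix \<nu> assume "\<nu> \<in> {2..n-1}"
      then have "w \<nu> > 0" "(1 - z \<nu>) \<ge> 0"
        using lobatto_weight_pos[of \<nu>] lobatto_node_interior[of \<nu>] by auto
      moreover have "poly ([:1, -1:] * r\<^sup>2) (z \<nu>) = (1 - z \<nu>) * (poly r (z \<nu>))\<^sup>2"
        by (simp add: poly_power algebra_simps)
      ultimately show "w \<nu> * poly ([:1, -1:] * r\<^sup>2) (z \<nu>) \<ge> 0"
        by simp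
    qed
    then show ?thesis
      unfolding lobatto_sum_ends using lobatto_facts by (simp add: poly_power pr)
  qed
  finally have 1: "w 1 * (poly q 1)\<^sup>2 \<le> w n * (poly q 1)\<^sup>2" .
  have "w 1 * (poly q 0)\<^sup>2 = (\<Sum>\<nu>=1..n. w \<nu> * poly b (z \<nu>))"
    unfolding lobatto_sum_ends using q(2) lobatto_facts(3,4) by (simp add: b_def poly_power)
  also have "\<dots> = integral {0..1} (poly b)"
    unfolding b_def by (rule lobatto_exact[OF dg[OF q(1)]])
  also have "\<dots> = integral {0..1} (poly ([:0, 1:] * r\<^sup>2))"
    using integral_poly_reflect[of b] refl by simp
  also have "\<dots> = (\<Sum>\<nu>=1..n. w \<nu> * poly ([:0, 1:] * r\<^sup>2) (z \<nu>))"
    by (rule lobatto_exact[OF dg[OF dr], symmetric])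
  also have "\<dots> \<ge> w n * (poly q 0)\<^sup>2"
  proof -
    have "(\<Sum>\<nu>=2..n-1. w \<nu> * poly ([:0, 1:] * r\<^sup>2) (z \<nu>)) \<ge> 0"
    proof (rule sum_nonneg)
      fix \<nu> assume "\<nu> \<in> {2..n-1}"
      then have "w \<nu> > 0" "z \<nu> \<ge> 0"
        using lobatto_weight_pos[of \<nu>] lobatto_node_interior[of \<nu>] by auto
      moreover have "poly ([:0, 1:] * r\<^sup>2) (z \<nu>) = z \<nu> * (poly r (z \<nu>))\<^sup>2"
        by (simp add: poly_power algebra_simps)
      ultimately show "w \<nu> * poly ([:0, 1:] * r\<^sup>2) (z \<nu>) \<ge> 0"
        by simp
    qed
    then show ?thesis
      unfolding lobatto_sum_ends using lobatto_facts by (simp add: poly_power pr)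
  qed
  finally have 2: "w n * (poly q 0)\<^sup>2 \<le> w 1 * (poly q 0)\<^sup>2" .
  from 1 2 q(3,4) show ?thesis by simp
qed

end

lemma quadrature_has_integral:
  fixes z w :: "nat \<Rightarrow> real" and f :: "real poly"
  assumes ex: "\<And>f :: real poly. degree f \<le> D \<Longrightarrow>
      (\<Sum>\<nu>=1..n. w \<nu> * poly f (z \<nu>)) = integral {0..1} (poly f)"
    and f: "degree f \<le> D" and h: "h > 0"
  shows "(poly f has_integral h * (\<Sum>\<nu>=1..n. w \<nu> * poly f (a + z \<nu> * h))) {a..a+h}"
proof -
  define g where "g = f \<circ>\<^sub>p [:a, h:]"
  have pg: "poly g x = poly f (a + x * h)" for x
    by (simp add: g_def poly_pcompose)
  have "degree g \<le> D" using f h by (simp add: g_def degree_pcompose)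
  then have "integral {0..1} (poly g) = (\<Sum>\<nu>=1..n. w \<nu> * poly f (a + z \<nu> * h))"
    using ex[of g] by (simp add: pg)
  moreover have int: "(poly f has_integral integral {a..a+h} (poly f)) {a..a+h}"
    by (rule integrable_integral[OF poly_integrable])
  have "((\<lambda>x. poly f (h *\<^sub>R x + a)) has_integral integral {a..a+h} (poly f) /\<^sub>R h ^ DIM(real))
      (cbox ((a - a) /\<^sub>R h) ((a + h - a) /\<^sub>R h))"
    by (rule has_integral_affinity') (use int h in auto)
  then have "integral {0..1} (poly g) = integral {a..a+h} (poly f) / h"
    using h by (intro integral_unique) (simp add: pg[abs_def] algebra_simps field_simps)
  ultimately show ?thesis
    using int h by (simp add: field_simps)
qed

section \<open>Cell averages\<close>

text \<open>Turns the coefficients behind \<open>polynomial_on\<close> into a function on the whole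
  plane, which can be evaluated on cell boundaries where the field itself may jump.\<close>

definition poly2 :: "nat \<Rightarrow> (nat \<Rightarrow> nat \<Rightarrow> state) \<Rightarrow> real \<times> real \<Rightarrow> state" where
  "poly2 k c z = (\<Sum>r\<le>k. \<Sum>s\<le>k - r. (fst z ^ r * snd z ^ s) *\<^sub>R c r s)"

lemma continuous_on_poly2: "continuous_on S (poly2 k c)"
  unfolding poly2_def[abs_def] by (intro continuous_intros)

lemma box_Pair_eq: "box (a, c) (b, d) = box a b \<times> box c d"
  by (simp add: box_prod)

text \<open>The area factor \<open>h * g\<close> is left out, so that the value is an average over
  the rectangle.\<close>

definition tensor_rule ::
    "real \<Rightarrow> real \<Rightarrow> nat \<Rightarrow> (nat \<Rightarrow> real) \<Rightarrow> (nat \<Rightarrow> real) \<Rightarrow> real \<Rightarrow> real \<Rightarrow> nat \<Rightarrow> (nat \<Rightarrow> real) \<Rightarrow> (nat \<Rightarrow> real)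
      \<Rightarrow> (real \<times> real \<Rightarrow> 'a::real_vector) \<Rightarrow> 'a" where
  "tensor_rule a h n z w b g m y v f =
    (\<Sum>\<nu>=1..n. \<Sum>\<mu>=1..m. (w \<nu> * v \<mu>) *\<^sub>R f (a + z \<nu> * h, b + y \<mu> * g))"

lemma tensor_rule_sum:
  assumes "finite A"
  shows "tensor_rule a h n z w b g m y v (\<lambda>x. \<Sum>i\<in>A. f i x)
    = (\<Sum>i\<in>A. tensor_rule a h n z w b g m y v (f i))"
  using assms
proof induction
  case empty
  then show ?case by (simp add: tensor_rule_def)
next
  case (insert i A)
  have "tensor_rule a h n z w b g m y v (\<lambda>x. f i x + (\<Sum>i\<in>A. f i x))
      = tensor_rule a h n z w b g m y v (f i) + tensor_rule a h n z w b g m y v (\<lambda>x. \<Sum>i\<in>A. f i x)"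
    by (simp add: tensor_rule_def scaleR_add_right sum.distrib)
  with insert show ?case by simp
qed

lemma monomial_has_integral:
  assumes x: "((\<lambda>x. x ^ r) has_integral X) {a..a + h}"
    and y: "((\<lambda>y. y ^ s) has_integral Y) {b..b + g}"
  shows "((\<lambda>z :: real \<times> real. fst z ^ r * snd z ^ s) has_integral X * Y) (cbox (a, b) (a + h, b + g))"
proof -
  have cont: "continuous_on (cbox (a, b) (a + h, b + g)) (\<lambda>z :: real \<times> real. fst z ^ r * snd z ^ s)"
    by (intro continuous_intros)
  have "integral (cbox (a, b) (a + h, b + g)) (\<lambda>z. fst z ^ r * snd z ^ s)
      = integral (cbox a (a + h)) (\<lambda>x. integral (cbox b (b + g)) (\<lambda>y. x ^ r * y ^ s))"
    using integral_prod_continuous[OF cont] by simp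
  also have "\<dots> = integral (cbox a (a + h)) (\<lambda>x. x ^ r * Y)"
    using y by (simp add: integral_unique cbox_interval)
  also have "\<dots> = X * Y"
    using x by (simp add: integral_unique cbox_interval)
  finally show ?thesis
    using integrable_continuous[OF cont] by (simp add: has_integral_iff)
qed

text \<open>By linearity it suffices to treat monomials. Total degree at most \<open>k\<close>
  bounds the degree in each variable, so each one-dimensional rule is exact on its own
  factor.\<close>

lemma tensor_rule_exact:
  fixes z w y v :: "nat \<Rightarrow> real"
  assumes x: "\<And>f :: real poly. degree f \<le> k \<Longrightarrow>
      (\<Sum>\<nu>=1..n. w \<nu> * poly f (z \<nu>)) = integral {0..1} (poly f)"
    and y: "\<And>f :: real poly. degree f \<le> k \<Longrightarrow>
      (\<Sum>\<mu>=1..m. v \<mu> * poly f (y \<mu>)) = integral {0..1} (poly f)"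
    and h: "h > 0" and g: "g > 0"
  shows "(poly2 k c has_integral (h * g) *\<^sub>R tensor_rule a h n z w b g m y v (poly2 k c))
    (cbox (a, b) (a + h, b + g))"
proof -
  have mono: "((\<lambda>x. (fst x ^ r * snd x ^ s) *\<^sub>R c r s) has_integral
      (h * g) *\<^sub>R tensor_rule a h n z w b g m y v (\<lambda>x. (fst x ^ r * snd x ^ s) *\<^sub>R c r s))
      (cbox (a, b) (a + h, b + g))" if "r \<le> k" "s \<le> k" for r s
  proof -
    have pm: "poly (monom 1 r) = (\<lambda>x::real. x ^ r)" for r
      by (simp add: fun_eq_iff poly_monom)
    have dm: "degree (monom (1::real) r) \<le> k" if "r \<le> k" for r
      using that by (simp add: degree_monom_eq)
    have X: "((\<lambda>x. x ^ r) has_integral h * (\<Sum>\<nu>=1..n. w \<nu> * (a + z \<nu> * h) ^ r)) {a..a + h}"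
      using quadrature_has_integral[OF x dm[OF that(1)] h, of a] by (simp add: pm)
    have Y: "((\<lambda>x. x ^ s) has_integral g * (\<Sum>\<mu>=1..m. v \<mu> * (b + y \<mu> * g) ^ s)) {b..b + g}"
      using quadrature_has_integral[OF y dm[OF that(2)] g, of b] by (simp add: pm)
    have "(h * (\<Sum>\<nu>=1..n. w \<nu> * (a + z \<nu> * h) ^ r) * (g * (\<Sum>\<mu>=1..m. v \<mu> * (b + y \<mu> * g) ^ s))) *\<^sub>R c r s
       = (h * g) *\<^sub>R ((\<Sum>\<nu>=1..n. w \<nu> * (a + z \<nu> * h) ^ r) * (\<Sum>\<mu>=1..m. v \<mu> * (b + y \<mu> * g) ^ s)) *\<^sub>R c r s"
      by (simp add: mult_ac)
    also have "\<dots> = (h * g) *\<^sub>R tensor_rule a h n z w b g m y v (\<lambda>x. (fst x ^ r * snd x ^ s) *\<^sub>R c r s)"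
      unfolding tensor_rule_def sum_product by (simp add: scaleR_sum_left mult_ac)
    finally show ?thesis
      using has_integral_scaleR_left[OF monomial_has_integral[OF X Y], of "c r s"] by simp
  qed
  have "((\<lambda>x. \<Sum>r\<le>k. \<Sum>s\<le>k - r. (fst x ^ r * snd x ^ s) *\<^sub>R c r s) has_integral
      (\<Sum>r\<le>k. \<Sum>s\<le>k - r. (h * g) *\<^sub>R tensor_rule a h n z w b g m y v (\<lambda>x. (fst x ^ r * snd x ^ s) *\<^sub>R c r s)))
      (cbox (a, b) (a + h, b + g))"
    by (intro has_integral_sum mono) auto
  then show ?thesis
    by (simp add: poly2_def[abs_def] tensor_rule_sum scaleR_sum_right)
qed

text \<open>Each column is glued along the line \<open>yb\<close>, then the two columns along
  \<open>xb\<close>.\<close>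

lemma has_integral_quarters:
  fixes f :: "real \<times> real \<Rightarrow> 'b::real_normed_vector"
  assumes ab: "xa \<le> xb" "xb \<le> xc" "ya \<le> yb" "yb \<le> yc"
    and "(f has_integral I00) (cbox (xa, ya) (xb, yb))"
    and "(f has_integral I01) (cbox (xa, yb) (xb, yc))"
    and "(f has_integral I10) (cbox (xb, ya) (xc, yb))"
    and "(f has_integral I11) (cbox (xb, yb) (xc, yc))"
  shows "(f has_integral (I00 + I01) + (I10 + I11)) (cbox (xa, ya) (xc, yc))"
proof -
  have col: "(f has_integral I + J) (cbox (a, ya) (b, yc))"
    if "(f has_integral I) (cbox (a, ya) (b, yb))" "(f has_integral J) (cbox (a, yb) (b, yc))" for a b I J
  proof (rule has_integral_split)
    show "(0, 1) \<in> (Basis :: (real \<times> real) set)" by (simp add: Basis_prod_def)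
    have "cbox (a, ya) (b, yc) \<inter> {x. x \<bullet> (0, 1) \<le> yb} = cbox (a, ya) (b, yb)"
      "cbox (a, ya) (b, yc) \<inter> {x. x \<bullet> (0, 1) \<ge> yb} = cbox (a, yb) (b, yc)"
      using ab by (auto simp: cbox_Pair_eq)
    with that show "(f has_integral I) (cbox (a, ya) (b, yc) \<inter> {x. x \<bullet> (0, 1) \<le> yb})"
      "(f has_integral J) (cbox (a, ya) (b, yc) \<inter> {x. x \<bullet> (0, 1) \<ge> yb})"
      by simp_all
  qed
  show ?thesis
  proof (rule has_integral_split)
    show "(1, 0) \<in> (Basis :: (real \<times> real) set)" by (simp add: Basis_prod_def)
    have "cbox (xa, ya) (xc, yc) \<inter> {x. x \<bullet> (1, 0) \<le> xb} = cbox (xa, ya) (xb, yc)"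
      "cbox (xa, ya) (xc, yc) \<inter> {x. x \<bullet> (1, 0) \<ge> xb} = cbox (xb, ya) (xc, yc)"
      using ab by (auto simp: cbox_Pair_eq)
    with assms show "(f has_integral I00 + I01) (cbox (xa, ya) (xc, yc) \<inter> {x. x \<bullet> (1, 0) \<le> xb})"
      "(f has_integral I10 + I11) (cbox (xa, ya) (xc, yc) \<inter> {x. x \<bullet> (1, 0) \<ge> xb})"
      using col by simp_all
  qed
qed

section \<open>Quarter cells, one-sided limits and averages\<close>

lemma quarter_cell_eq_box:
  "quarter_cell M c d = box (xpos M (c - 1/4), ypos M (d - 1/4)) (xpos M (c + 1/4), ypos M (d + 1/4))"
  by (simp add: quarter_cell_def box_Pair_eq box_real)

lemma cell_eq_box:
  "cell M i j = box (xpos M (i - 1/2), ypos M (j - 1/2)) (xpos M (i + 1/2), ypos M (j + 1/2))"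
  by (simp add: cell_def box_Pair_eq box_real)

lemma xpos_add: "xpos M (i + t) = xpos M i + t * dx M"
  by (simp add: xpos_def algebra_simps)

lemma ypos_add: "ypos M (j + t) = ypos M j + t * dy M"
  by (simp add: ypos_def algebra_simps)

lemma xpos_diff: "xpos M (i - t) = xpos M i - t * dx M"
  by (simp add: xpos_def algebra_simps)

lemma ypos_diff: "ypos M (j - t) = ypos M j - t * dy M"
  by (simp add: ypos_def algebra_simps)

lemmas pos_simps = xpos_add ypos_add xpos_diff ypos_diff

lemma islimpt_box:
  fixes x :: "'a::euclidean_space"
  assumes "box a b \<noteq> {}" "x \<in> cbox a b"
  shows "x islimpt box a b"
proof (cases "x \<in> box a b")
  case True
  then show ?thesis by (intro interior_limit_point) (simp add: interior_open open_box)
next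
  case False
  then show ?thesis using closure_box[OF assms(1)] assms(2) by (auto simp: closure_def)
qed

text \<open>The limit sees only the open quarter cell, where the field agrees with the continuous
  \<open>f\<close>. Every point of the closed box is a limit point of it, so the limit is
  unique.\<close>

lemma trace_eq:
  assumes "dx M > 0" "dy M > 0"
    and W: "\<And>z. z \<in> quarter_cell M c d \<Longrightarrow> W z = f z"
    and f: "continuous_on UNIV f"
    and z: "z \<in> cbox (xpos M (c - 1/4), ypos M (d - 1/4)) (xpos M (c + 1/4), ypos M (d + 1/4))"
  shows "trace M W c d z = f z"
proof -
  have "z islimpt quarter_cell M c d"
    unfolding quarter_cell_eq_box
    by (rule islimpt_box[OF _ z]) (use assms(1,2) in \<open>simp add: box_Pair_eq pos_simps\<close>)
  then have nt: "at z within quarter_cell M c d \<noteq> bot"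
    by (simp add: trivial_limit_within)
  have "(f \<longlongrightarrow> f z) (at z within quarter_cell M c d)"
    using f by (metis UNIV_I continuous_on_def subset_UNIV tendsto_within_subset)
  then have "(W \<longlongrightarrow> f z) (at z within quarter_cell M c d)"
    by (rule Lim_transform_eventually) (simp add: eventually_at_filter W)
  then show ?thesis
    unfolding trace_def using nt by (rule tendsto_Lim[rotated])
qed

text \<open>A cell meets four cells of the other mesh, each in a quarter cell. Values on the
  dividing lines do not affect the integral, and the factor \<open>1/4\<close> is the ratio of the
  areas.\<close>

lemma cell_avg_eq:
  fixes z w y v :: "nat \<Rightarrow> real"
  assumes pos: "dx M > 0" "dy M > 0"
    and x: "\<And>f :: real poly. degree f \<le> k \<Longrightarrow>
      (\<Sum>\<nu>=1..n. w \<nu> * poly f (z \<nu>)) = integral {0..1} (poly f)"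
    and y: "\<And>f :: real poly. degree f \<le> k \<Longrightarrow>
      (\<Sum>\<mu>=1..m. v \<mu> * poly f (y \<mu>)) = integral {0..1} (poly f)"
    and W: "\<And>\<sigma> \<tau> z. \<sigma> \<in> {-1, 1} \<Longrightarrow> \<tau> \<in> {-1, 1} \<Longrightarrow> z \<in> quarter_cell M (i + \<sigma>/4) (j + \<tau>/4)
      \<Longrightarrow> W z = poly2 k (c \<sigma> \<tau>) z"
  shows "cell_avg M W i j = (1/4) *\<^sub>R (\<Sum>\<sigma>\<in>{-1, 1}. \<Sum>\<tau>\<in>{-1, 1}.
    tensor_rule (xpos M (i + \<sigma>/4 - 1/4)) (dx M / 2) n z w (ypos M (j + \<tau>/4 - 1/4)) (dy M / 2) m y v
      (poly2 k (c \<sigma> \<tau>)))"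
proof -
  define I where "I \<sigma> \<tau> = (dx M / 2 * (dy M / 2)) *\<^sub>R
    tensor_rule (xpos M (i + \<sigma>/4 - 1/4)) (dx M / 2) n z w (ypos M (j + \<tau>/4 - 1/4)) (dy M / 2) m y v
      (poly2 k (c \<sigma> \<tau>))" for \<sigma> \<tau>
  have q: "(W has_integral I \<sigma> \<tau>) (cbox (xpos M (i + \<sigma>/4 - 1/4), ypos M (j + \<tau>/4 - 1/4))
      (xpos M (i + \<sigma>/4 - 1/4) + dx M / 2, ypos M (j + \<tau>/4 - 1/4) + dy M / 2))"
    if st: "\<sigma> \<in> {-1, 1}" "\<tau> \<in> {-1, 1}" for \<sigma> \<tau>
  proof (rule has_integral_spike_interior)
    show "(poly2 k (c \<sigma> \<tau>) has_integral I \<sigma> \<tau>) (cbox (xpos M (i + \<sigma>/4 - 1/4), ypos M (j + \<tau>/4 - 1/4))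
      (xpos M (i + \<sigma>/4 - 1/4) + dx M / 2, ypos M (j + \<tau>/4 - 1/4) + dy M / 2))"
      unfolding I_def by (rule tensor_rule_exact[OF x y]) (use pos in auto)
    show "W u = poly2 k (c \<sigma> \<tau>) u" if "u \<in> box (xpos M (i + \<sigma>/4 - 1/4), ypos M (j + \<tau>/4 - 1/4))
      (xpos M (i + \<sigma>/4 - 1/4) + dx M / 2, ypos M (j + \<tau>/4 - 1/4) + dy M / 2)" for u
      using that by (intro W st) (simp add: quarter_cell_eq_box pos_simps algebra_simps)
  qed
  have "(W has_integral (I (-1) (-1) + I (-1) 1) + (I 1 (-1) + I 1 1))
      (cbox (xpos M i - dx M / 2, ypos M j - dy M / 2) (xpos M i + dx M / 2, ypos M j + dy M / 2))"
    by (rule has_integral_quarters[where xb = "xpos M i" and yb = "ypos M j"])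
      (use pos q[of "-1" "-1"] q[of "-1" 1] q[of 1 "-1"] q[of 1 1] in \<open>simp_all add: pos_simps\<close>)
  then have "integral (cell M i j) W = (I (-1) (-1) + I (-1) 1) + (I 1 (-1) + I 1 1)"
    by (simp add: cell_eq_box integral_open_interval integral_unique pos_simps)
  then show ?thesis
    using pos by (simp add: cell_avg_def I_def scaleR_add_right)
qed

section \<open>Update of one cell\<close>

text \<open>Covers both updates: \<open>U\<close> is the field on the mesh of the cell,
  \<open>W\<close> the one on the other mesh, and the indices may be integers or half-odd. The signs
  \<sigma> and \<tau> select a quarter cell.\<close>

locale cell_update =
  fixes p :: eos and M :: mesh and Q :: quadrature and k :: nat
    and U W :: field2 and i j a1 a2 \<Delta>t \<tau>max \<theta> lam1 lam2 :: real
  assumes eos: "\<And>r e. r > 0 \<Longrightarrow> p r e > 0 \<longleftrightarrow> e > 0"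
    and mesh: "dx M > 0" "dy M > 0"
    and gauss: "gnum Q = k + 1" "gauss_rule (gnum Q) (gnode Q) (gweight Q)"
    and lobatto: "lnum Q = nat \<lceil>(real k + 3) / 2\<rceil>"
      "gauss_lobatto_rule (lnum Q) (lnode Q) (lweight Q)"
    and poly: "\<And>\<sigma> \<tau>. \<sigma> \<in> {-1, 1} \<Longrightarrow> \<tau> \<in> {-1, 1} \<Longrightarrow>
      polynomial_on k (cell M (i + \<sigma>/2) (j + \<tau>/2)) W"
    and avg: "cell_avg M U i j \<in> admissible"
    and nodes: "node_values M Q W i j \<subseteq> admissible"
    and speed1: "\<And>y. y \<in> Qy M Q j \<Longrightarrow>
      wave_bound p 1 (W (xpos M (i + 1/2), y)) (W (xpos M (i - 1/2), y)) \<le> a1"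
    and speed2: "\<And>x. x \<in> Qx M Q i \<Longrightarrow>
      wave_bound p 2 (W (x, ypos M (j + 1/2))) (W (x, ypos M (j - 1/2))) \<le> a2"
    and steps: "\<Delta>t > 0" "\<tau>max > 0"
    and theta: "\<theta> = \<Delta>t / \<tau>max" "0 < \<theta>" "\<theta> \<le> 1"
    and lam: "lam1 = a1 * \<Delta>t / dx M" "lam2 = a2 * \<Delta>t / dy M"
    and cfl: "lam1 + lam2 < \<theta> * lweight Q 1 / 2"
begin

definition "coef \<sigma> \<tau> = (SOME c. \<forall>z\<in>cell M (i + \<sigma>/2) (j + \<tau>/2). W z = poly2 k c z)"

definition "piece \<sigma> \<tau> = poly2 k (coef \<sigma> \<tau>)"

lemma W_cell:
  assumes "\<sigma> \<in> {-1, 1}" "\<tau> \<in> {-1, 1}" and z: "z \<in> cell M (i + \<sigma>/2) (j + \<tau>/2)"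
  shows "W z = piece \<sigma> \<tau> z"
proof -
  obtain c where "\<forall>(x, y)\<in>cell M (i + \<sigma>/2) (j + \<tau>/2).
      W (x, y) = (\<Sum>r\<le>k. \<Sum>s\<le>k - r. (x ^ r * y ^ s) *\<^sub>R c r s)"
    using poly[OF assms(1,2)] unfolding polynomial_on_def by blast
  then have "\<forall>z\<in>cell M (i + \<sigma>/2) (j + \<tau>/2). W z = poly2 k c z"
    by (auto simp: poly2_def)
  then have "\<forall>z\<in>cell M (i + \<sigma>/2) (j + \<tau>/2). W z = poly2 k (coef \<sigma> \<tau>) z"
    unfolding coef_def by (rule someI[where P = "\<lambda>c. \<forall>z\<in>cell M (i + \<sigma>/2) (j + \<tau>/2). W z = poly2 k c z"])
  with z show ?thesis by (simp add: piece_def)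
qed

lemma cell_iff:
  "(x, y) \<in> cell M c d \<longleftrightarrow> 
    xpos M c - dx M / 2 < x \<and> x < xpos M c + dx M / 2 \<and>
    ypos M d - dy M / 2 < y \<and> y < ypos M d + dy M / 2"
  by (auto simp: cell_def pos_simps)

lemma quarter_cell_iff:
  "(x, y) \<in> quarter_cell M c d \<longleftrightarrow> 
    xpos M c - dx M / 4 < x \<and> x < xpos M c + dx M / 4 \<and>
    ypos M d - dy M / 4 < y \<and> y < ypos M d + dy M / 4"
  by (auto simp: quarter_cell_def pos_simps)

lemma quarter_cell_subset:
  assumes "\<sigma> \<in> {-1, 1}" "\<tau> \<in> {-1, 1}"
  shows "quarter_cell M (i + \<sigma>/4) (j + \<tau>/4) \<subseteq> cell M (i + \<sigma>/2) (j + \<tau>/2)"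
  using assms by (auto simp: quarter_cell_iff cell_iff pos_simps)

lemma W_quarter:
  assumes "\<sigma> \<in> {-1, 1}" "\<tau> \<in> {-1, 1}" and "z \<in> quarter_cell M (i + \<sigma>/4) (j + \<tau>/4)"
  shows "W z = piece \<sigma> \<tau> z"
  using W_cell[OF assms(1,2)] quarter_cell_subset[OF assms(1,2)] assms(3) by blast

lemma trace_piece:
  assumes "\<sigma> \<in> {-1, 1}" "\<tau> \<in> {-1, 1}"
    and "s \<in> {0..1}" "t \<in> {0..1}"
  shows "trace M W (i + \<sigma>/4) (j + \<tau>/4)
      (xpos M (i + \<sigma>/4 - 1/4) + s * (dx M / 2), ypos M (j + \<tau>/4 - 1/4) + t * (dy M / 2)) =
    piece \<sigma> \<tau> (xpos M (i + \<sigma>/4 - 1/4) + s * (dx M / 2), ypos M (j + \<tau>/4 - 1/4) + t * (dy M / 2))"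
proof (rule trace_eq[OF mesh W_quarter[OF assms(1,2)]])
  show "continuous_on UNIV (piece \<sigma> \<tau>)"
    unfolding piece_def by (rule continuous_on_poly2)
  have "s * dx M \<le> dx M" "t * dy M \<le> dy M" "0 \<le> s * dx M" "0 \<le> t * dy M"
    using assms(3,4) mesh by (simp_all add: mult_left_le_one_le)
  then show "(xpos M (i + \<sigma>/4 - 1/4) + s * (dx M / 2), ypos M (j + \<tau>/4 - 1/4) + t * (dy M / 2)) \<in>
      cbox (xpos M (i + \<sigma>/4 - 1/4), ypos M (j + \<tau>/4 - 1/4)) (xpos M (i + \<sigma>/4 + 1/4), ypos M (j + \<tau>/4 + 1/4))"
    by (auto simp: pos_simps)
qed

abbreviation "N \<equiv> gnum Q"
abbreviation "L \<equiv> lnum Q"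

text \<open>In both definitions \<nu> counts Lobatto nodes in the direction of the flux and \<mu>
  counts Gauss nodes along the face.\<close>

definition "xstate \<sigma> \<tau> \<nu> \<mu> = piece \<sigma> \<tau> (lx M Q (i + \<sigma>/4) \<nu>, gy M Q (j + \<tau>/4) \<mu>)"
definition "ystate \<sigma> \<tau> \<nu> \<mu> = piece \<sigma> \<tau> (gx M Q (i + \<sigma>/4) \<mu>, ly M Q (j + \<tau>/4) \<nu>)"

lemma gauss_node_range: "\<mu> \<in> {1..N} \<Longrightarrow> 0 < gnode Q \<mu> \<and> gnode Q \<mu> < 1"
  using gauss(2) unfolding gauss_rule_def by fastforce

lemma trace_state:
  assumes st: "\<sigma> \<in> {-1, 1}" "\<tau> \<in> {-1, 1}" and "\<nu> \<in> {1..L}" "\<mu> \<in> {1..N}"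
  shows "trace M W (i + \<sigma>/4) (j + \<tau>/4) (lx M Q (i + \<sigma>/4) \<nu>, gy M Q (j + \<tau>/4) \<mu>) = xstate \<sigma> \<tau> \<nu> \<mu>"
    and "trace M W (i + \<sigma>/4) (j + \<tau>/4) (gx M Q (i + \<sigma>/4) \<mu>, ly M Q (j + \<tau>/4) \<nu>) = ystate \<sigma> \<tau> \<nu> \<mu>"
  unfolding xstate_def ystate_def lx_def ly_def gx_def gy_def
  using lobatto_node_range[OF lobatto(2) assms(3)] gauss_node_range[OF assms(4)]
  by (intro trace_piece st; simp)+

lemma states_admissible:
  assumes st: "\<sigma> \<in> {-1, 1}" "\<tau> \<in> {-1, 1}" and nm: "\<nu> \<in> {1..L}" "\<mu> \<in> {1..N}"
  shows "xstate \<sigma> \<tau> \<nu> \<mu> \<in> admissible" "ystate \<sigma> \<tau> \<nu> \<mu> \<in> admissible"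
proof -
  have "trace M W (i + \<sigma>/4) (j + \<tau>/4) (lx M Q (i + \<sigma>/4) \<nu>, gy M Q (j + \<tau>/4) \<mu>) \<in> node_values M Q W i j"
    unfolding node_values_def
    by (rule UN_I[OF st(1)], rule UN_I[OF st(2)], rule imageI) (use nm in auto)
  then show "xstate \<sigma> \<tau> \<nu> \<mu> \<in> admissible"
    using trace_state(1)[OF assms] nodes by auto
  have "trace M W (i + \<sigma>/4) (j + \<tau>/4) (gx M Q (i + \<sigma>/4) \<mu>, ly M Q (j + \<tau>/4) \<nu>) \<in> node_values M Q W i j"
    unfolding node_values_def
    by (rule UN_I[OF st(1)], rule UN_I[OF st(2)], rule imageI) (use nm in auto)
  then show "ystate \<sigma> \<tau> \<nu> \<mu> \<in> admissible"
    using trace_state(2)[OF assms] nodes by auto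
qed

text \<open>The faces of the cell are centre lines of cells of the other mesh, and Gauss nodes avoid
  the endpoints of the half-intervals. So \<open>W\<close> is polynomial near these points, and its
  value is the one at an outer Lobatto node.\<close>

lemma face_values:
  assumes st: "\<tau> \<in> {-1, 1}" and m: "\<mu> \<in> {1..N}"
  shows "W (xpos M (i + 1/2), gy M Q (j + \<tau>/4) \<mu>) = xstate 1 \<tau> L \<mu>"
    and "W (xpos M (i - 1/2), gy M Q (j + \<tau>/4) \<mu>) = xstate (-1) \<tau> 1 \<mu>"
    and "W (gx M Q (i + \<tau>/4) \<mu>, ypos M (j + 1/2)) = ystate \<tau> 1 L \<mu>"
    and "W (gx M Q (i + \<tau>/4) \<mu>, ypos M (j - 1/2)) = ystate \<tau> (-1) 1 \<mu>"
proof -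
  note l = lobatto_facts(3,4)[OF lobatto(2)]
  note g = gauss_node_range[OF m]
  have d: "0 < gnode Q \<mu> * dx M" "gnode Q \<mu> * dx M < dx M" "0 < gnode Q \<mu> * dy M" "gnode Q \<mu> * dy M < dy M"
    using g mesh by simp_all
  have "W (xpos M (i + 1/2), gy M Q (j + \<tau>/4) \<mu>) = piece 1 \<tau> (xpos M (i + 1/2), gy M Q (j + \<tau>/4) \<mu>)"
    using st d mesh by (intro W_cell) (auto simp: cell_iff gy_def pos_simps)
  moreover have "xpos M (i + 1/2) = lx M Q (i + 1/4) L"
    using l by (simp add: lx_def pos_simps)
  ultimately show "W (xpos M (i + 1/2), gy M Q (j + \<tau>/4) \<mu>) = xstate 1 \<tau> L \<mu>"
    by (simp add: xstate_def)
  have "W (xpos M (i - 1/2), gy M Q (j + \<tau>/4) \<mu>) = piece (-1) \<tau> (xpos M (i - 1/2), gy M Q (j + \<tau>/4) \<mu>)"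
    using st d mesh by (intro W_cell) (auto simp: cell_iff gy_def pos_simps)
  moreover have "xpos M (i - 1/2) = lx M Q (i + - 1/4) 1"
    using l by (simp add: lx_def pos_simps)
  ultimately show "W (xpos M (i - 1/2), gy M Q (j + \<tau>/4) \<mu>) = xstate (-1) \<tau> 1 \<mu>"
    by (simp add: xstate_def)
  have "W (gx M Q (i + \<tau>/4) \<mu>, ypos M (j + 1/2)) = piece \<tau> 1 (gx M Q (i + \<tau>/4) \<mu>, ypos M (j + 1/2))"
    using st d mesh by (intro W_cell) (auto simp: cell_iff gx_def pos_simps)
  moreover have "ypos M (j + 1/2) = ly M Q (j + 1/4) L"
    using l by (simp add: ly_def pos_simps)
  ultimately show "W (gx M Q (i + \<tau>/4) \<mu>, ypos M (j + 1/2)) = ystate \<tau> 1 L \<mu>"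
    by (simp add: ystate_def)
  have "W (gx M Q (i + \<tau>/4) \<mu>, ypos M (j - 1/2)) = piece \<tau> (-1) (gx M Q (i + \<tau>/4) \<mu>, ypos M (j - 1/2))"
    using st d mesh by (intro W_cell) (auto simp: cell_iff gx_def pos_simps)
  moreover have "ypos M (j - 1/2) = ly M Q (j + - 1/4) 1"
    using l by (simp add: ly_def pos_simps)
  ultimately show "W (gx M Q (i + \<tau>/4) \<mu>, ypos M (j - 1/2)) = ystate \<tau> (-1) 1 \<mu>"
    by (simp add: ystate_def)
qed

text \<open>The ceiling in the definition of \<open>L\<close> gives
  \<open>k + 3 \<le> 2 * L\<close>, which is exactness on degree \<open>k\<close>.\<close>

lemma lobatto_exact_k:
  "degree f \<le> k \<Longrightarrow> (\<Sum>\<nu>=1..L. lweight Q \<nu> * poly f (lnode Q \<nu>)) = integral {0..1} (poly f)"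
proof (rule lobatto_exact[OF lobatto(2)])
  assume "degree f \<le> k"
  moreover have "(real k + 3) / 2 \<le> real L"
    unfolding lobatto(1) by (rule real_nat_ceiling_ge)
  then have "real (k + 3) \<le> real (2 * L)" by simp
  then have "k + 3 \<le> 2 * L" by (simp only: of_nat_le_iff)
  ultimately show "degree f \<le> 2 * L - 3" by simp
qed

lemma gauss_exact_k:
  "degree f \<le> k \<Longrightarrow> (\<Sum>\<mu>=1..N. gweight Q \<mu> * poly f (gnode Q \<mu>)) = integral {0..1} (poly f)"
  using gauss unfolding gauss_rule_def by simp

text \<open>Together with \<open>cell_avg_y\<close> this gives two expansions of one average. Each
  puts the Lobatto nodes in a different direction, exposing the states on the faces that the flux in
  this direction uses.\<close>

lemma cell_avg_x:
  "cell_avg M W i j = (1/4) *\<^sub>R (\<Sum>\<sigma>\<in>{-1, 1}. \<Sum>\<tau>\<in>{-1, 1}. \<Sum>\<nu>=1..L. \<Sum>\<mu>=1..N.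
    (lweight Q \<nu> * gweight Q \<mu>) *\<^sub>R xstate \<sigma> \<tau> \<nu> \<mu>)"
proof -
  note c = cell_avg_eq[OF mesh lobatto_exact_k gauss_exact_k W_quarter[unfolded piece_def]]
  show ?thesis
    by (subst c) (simp_all add: tensor_rule_def xstate_def lx_def gy_def piece_def)
qed

lemma cell_avg_y:
  "cell_avg M W i j = (1/4) *\<^sub>R (\<Sum>\<sigma>\<in>{-1, 1}. \<Sum>\<tau>\<in>{-1, 1}. \<Sum>\<mu>=1..N. \<Sum>\<nu>=1..L.
    (gweight Q \<mu> * lweight Q \<nu>) *\<^sub>R ystate \<sigma> \<tau> \<nu> \<mu>)"
proof -
  note c = cell_avg_eq[OF mesh gauss_exact_k lobatto_exact_k W_quarter[unfolded piece_def]]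
  show ?thesis
    by (subst c) (simp_all add: tensor_rule_def ystate_def ly_def gx_def piece_def)
qed

section \<open>Gauss averages over faces\<close>

lemmas gw_pos = gauss_weight_pos[OF gauss(2)]
lemmas gw_sum = gauss_weight_sum[OF gauss(2)]
lemmas lw_pos = lobatto_weight_pos[OF lobatto(2)]
lemmas lw_sum = lobatto_weight_sum[OF lobatto(2)]
lemmas lw_sym = lobatto_end_weights_eq[OF lobatto(2)]
lemmas L_ge = lobatto_facts(1)[OF lobatto(2)]

lemma N_ge: "1 \<in> {1..N}"
  using gauss(1) by simp

text \<open>A normalised positive functional over both halves of a face; halving the weights
  compensates for the two values of \<tau>.\<close>

definition "gavg f = (\<Sum>\<tau>\<in>{-1, 1 :: real}. \<Sum>\<mu>=1..N. gweight Q \<mu> / 2 * (f \<tau> \<mu> :: real))"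

lemma gavg_add: "gavg (\<lambda>\<tau> \<mu>. f \<tau> \<mu> + g \<tau> \<mu>) = gavg f + gavg g"
  by (simp add: gavg_def sum.distrib distrib_left)

lemma gavg_const: "gavg (\<lambda>\<tau> \<mu>. c) = c"
proof -
  have "(\<Sum>\<mu>=1..N. gweight Q \<mu> / 2 * c) = c / 2"
    using gw_sum by (simp add: sum_distrib_right[symmetric] sum_divide_distrib[symmetric])
  then show ?thesis unfolding gavg_def by simp
qed

lemma gavg_cmult: "gavg (\<lambda>\<tau> \<mu>. c * f \<tau> \<mu>) = c * gavg f"
  by (simp add: gavg_def sum_distrib_left distrib_left mult_ac)

lemma gavg_mono:
  assumes "\<And>\<tau> \<mu>. \<tau> \<in> {-1, 1} \<Longrightarrow> \<mu> \<in> {1..N} \<Longrightarrow> f \<tau> \<mu> \<le> g \<tau> \<mu>"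
  shows "gavg f \<le> gavg g"
  unfolding gavg_def
  using assms gw_pos by (intro sum_mono mult_left_mono) (auto intro: less_imp_le)

lemma gavg_cong:
  assumes "\<And>\<tau> \<mu>. \<tau> \<in> {-1, 1} \<Longrightarrow> \<mu> \<in> {1..N} \<Longrightarrow> f \<tau> \<mu> = g \<tau> \<mu>"
  shows "gavg f = gavg g"
  using assms by (intro antisym gavg_mono) auto

lemma gavg_pos:
  assumes "\<And>\<tau> \<mu>. \<tau> \<in> {-1, 1} \<Longrightarrow> \<mu> \<in> {1..N} \<Longrightarrow> f \<tau> \<mu> > 0"
  shows "gavg f > 0"
  unfolding gavg_def
  using assms gw_pos N_ge by (intro sum_pos mult_pos_pos) auto

lemma gavg_inner:
  "(\<Sum>\<tau>\<in>{-1, 1}. \<Sum>\<mu>=1..N. (gweight Q \<mu> / 2) *\<^sub>R F \<tau> \<mu>) \<bullet> n = gavg (\<lambda>\<tau> \<mu>. F \<tau> \<mu> \<bullet> n)" for n :: state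
  by (simp add: gavg_def inner_add_left inner_sum_left)

lemma speeds_at_faces:
  assumes "\<tau> \<in> {-1, 1}" "\<mu> \<in> {1..N}"
  shows "wave_bound p 1 (xstate 1 \<tau> L \<mu>) (xstate (-1) \<tau> 1 \<mu>) \<le> a1"
    and "wave_bound p 2 (ystate \<tau> 1 L \<mu>) (ystate \<tau> (-1) 1 \<mu>) \<le> a2"
proof -
  have "gy M Q (j + \<tau>/4) \<mu> \<in> Qy M Q j"
    unfolding Qy_def by (rule UN_I[OF assms(1)]) (use assms(2) in auto)
  from speed1[OF this] show "wave_bound p 1 (xstate 1 \<tau> L \<mu>) (xstate (-1) \<tau> 1 \<mu>) \<le> a1"
    using face_values[OF assms] by simp
  have "gx M Q (i + \<tau>/4) \<mu> \<in> Qx M Q i"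
    unfolding Qx_def by (rule UN_I[OF assms(1)]) (use assms(2) in auto)
  from speed2[OF this] show "wave_bound p 2 (ystate \<tau> 1 L \<mu>) (ystate \<tau> (-1) 1 \<mu>) \<le> a2"
    using face_values[OF assms] by simp
qed

lemma index_1L: "1 \<in> {1..L}" "L \<in> {1..L}"
  using L_ge by auto

lemma face_pairs:
  assumes "\<tau> \<in> {-1, 1}" "\<mu> \<in> {1..N}"
  shows "admissible_pair p 1 (xstate 1 \<tau> L \<mu>) (xstate (-1) \<tau> 1 \<mu>) a1"
    and "admissible_pair p 2 (ystate \<tau> 1 L \<mu>) (ystate \<tau> (-1) 1 \<mu>) a2"
  using eos speeds_at_faces[OF assms] assms index_1L states_admissible
  by (auto intro!: admissible_pair.intro)

lemma a_pos: "a1 > 0" "a2 > 0"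
  using face_pairs[of 1 1] N_ge by (auto intro: admissible_pair.alpha_pos)

lemma lam_pos: "lam1 > 0" "lam2 > 0"
  using a_pos steps mesh by (simp_all add: lam)

text \<open>The discrete divergence with a free observable \<open>d\<close>: the zero observable
  serves the density, and \<open>(vs \<bullet> Bs) * mag V $ l\<close> serves the energy.\<close>

definition ddiv :: "(3 \<Rightarrow> state \<Rightarrow> real) \<Rightarrow> real" where
  "ddiv d =
  1 / dx M * gavg (\<lambda>\<tau> \<mu>. d 1 (xstate 1 \<tau> L \<mu>) - d 1 (xstate (-1) \<tau> 1 \<mu>))
  + 1 / dy M * gavg (\<lambda>\<tau> \<mu>. d 2 (ystate \<tau> 1 L \<mu>) - d 2 (ystate \<tau> (-1) 1 \<mu>))"

text \<open>
  Both density and energy are covered by an affine functional \<open>V \<mapsto> V \<bullet> n + c\<close> that is positive on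
  \<open>admissible\<close>; \<open>d\<close> accounts for the divergence terms.
\<close>

context
  fixes n :: state and c :: real and d :: "3 \<Rightarrow> state \<Rightarrow> real"
  assumes pos: "\<And>V. V \<in> admissible \<Longrightarrow> V \<bullet> n + c > 0"
    and flux_bound: "\<And>l A B \<alpha>. admissible_pair p l A B \<alpha> \<Longrightarrow>
      (A + B) \<bullet> n + 2 * c - ((flux p l A - flux p l B) \<bullet> n - (d l A - d l B)) / \<alpha> \<ge> 0"
begin

definition "xmean \<sigma> \<nu> = gavg (\<lambda>\<tau> \<mu>. xstate \<sigma> \<tau> \<nu> \<mu> \<bullet> n + c)"
definition "ymean \<sigma> \<nu> = gavg (\<lambda>\<tau> \<mu>. ystate \<tau> \<sigma> \<nu> \<mu> \<bullet> n + c)"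

lemma mean_pos:
  assumes "\<sigma> \<in> {-1, 1}" "\<nu> \<in> {1..L}"
  shows "xmean \<sigma> \<nu> > 0" "ymean \<sigma> \<nu> > 0"
  unfolding xmean_def ymean_def using assms by (auto intro!: gavg_pos pos states_admissible)

lemma mean_eq:
  "gavg (\<lambda>\<tau> \<mu>. xstate \<sigma> \<tau> \<nu> \<mu> \<bullet> n) = xmean \<sigma> \<nu> - c"
  "gavg (\<lambda>\<tau> \<mu>. ystate \<tau> \<sigma> \<nu> \<mu> \<bullet> n) = ymean \<sigma> \<nu> - c"
  by (simp_all add: xmean_def ymean_def gavg_add gavg_const)

text \<open>The constant \<open>c\<close> distributes over both sums because their weights add up to
  1.\<close>

lemma Pi_inner:
  assumes s: "s \<in> {-1, 1}" and n: "\<nu> \<in> {1..L}"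
  shows "Pi_vec M Q lam1 lam2 W i j \<nu> s \<bullet> n + c
    = lam1 / (lam1 + lam2) * xmean s \<nu> + lam2 / (lam1 + lam2) * ymean s \<nu>"
proof -
  have "Pi_vec M Q lam1 lam2 W i j \<nu> s \<bullet> n
      = lam1 / (lam1 + lam2) * gavg (\<lambda>\<tau> \<mu>. xstate s \<tau> \<nu> \<mu> \<bullet> n)
        + lam2 / (lam1 + lam2) * gavg (\<lambda>\<tau> \<mu>. ystate \<tau> s \<nu> \<mu> \<bullet> n)"
    unfolding Pi_vec_def inner_add_left inner_scaleR_left gavg_inner
    by (intro arg_cong2[where f = "(+)"] arg_cong2[where f = "(*)"] gavg_cong refl)
      (use s n in \<open>simp_all add: trace_state\<close>)
  moreover have "lam1 / (lam1 + lam2) + lam2 / (lam1 + lam2) = 1"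
    using lam_pos by (simp add: add_divide_distrib[symmetric])
  then have "lam1 / (lam1 + lam2) * c + lam2 / (lam1 + lam2) * c = c"
    by (metis distrib_right mult_1)
  ultimately show ?thesis
    by (simp add: mean_eq right_diff_distrib)
qed

lemma lobatto_const: "(\<Sum>\<nu>=1..L. lweight Q \<nu> / 2 * c) = c / 2"
  using lw_sum by (simp add: sum_distrib_right[symmetric] sum_divide_distrib[symmetric])

lemma avg_inner_x: "cell_avg M W i j \<bullet> n + c = (\<Sum>\<sigma>\<in>{-1, 1}. \<Sum>\<nu>=1..L. lweight Q \<nu> / 2 * xmean \<sigma> \<nu>)"
proof -
  have "cell_avg M W i j \<bullet> n = (\<Sum>\<sigma>\<in>{-1, 1}. \<Sum>\<tau>\<in>{-1, 1}. \<Sum>\<nu>=1..L. \<Sum>\<mu>=1..N.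
      lweight Q \<nu> / 2 * (gweight Q \<mu> / 2 * (xstate \<sigma> \<tau> \<nu> \<mu> \<bullet> n)))"
    unfolding cell_avg_x inner_scaleR_left inner_sum_left sum_distrib_left
    by (intro sum.cong refl) simp
  also have "\<dots> = (\<Sum>\<sigma>\<in>{-1, 1}. \<Sum>\<nu>=1..L. \<Sum>\<tau>\<in>{-1, 1}. \<Sum>\<mu>=1..N.
      lweight Q \<nu> / 2 * (gweight Q \<mu> / 2 * (xstate \<sigma> \<tau> \<nu> \<mu> \<bullet> n)))"
    by (intro sum.cong refl sum.swap)
  also have "\<dots> = (\<Sum>\<sigma>\<in>{-1, 1}. \<Sum>\<nu>=1..L. lweight Q \<nu> / 2 * (xmean \<sigma> \<nu> - c))"
    unfolding mean_eq[symmetric] gavg_def by (intro sum.cong refl) (simp only: sum_distrib_left)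
  finally show ?thesis
    unfolding right_diff_distrib sum_subtractf lobatto_const by simp
qed

lemma avg_inner_y: "cell_avg M W i j \<bullet> n + c = (\<Sum>\<sigma>\<in>{-1, 1}. \<Sum>\<nu>=1..L. lweight Q \<nu> / 2 * ymean \<sigma> \<nu>)"
proof -
  have "cell_avg M W i j \<bullet> n = (\<Sum>\<sigma>\<in>{-1, 1}. \<Sum>\<tau>\<in>{-1, 1}. \<Sum>\<mu>=1..N. \<Sum>\<nu>=1..L.
      lweight Q \<nu> / 2 * (gweight Q \<mu> / 2 * (ystate \<sigma> \<tau> \<nu> \<mu> \<bullet> n)))"
    unfolding cell_avg_y inner_scaleR_left inner_sum_left sum_distrib_left
    by (intro sum.cong refl) simp
  also have "\<dots> = (\<Sum>\<tau>\<in>{-1, 1}. \<Sum>\<sigma>\<in>{-1, 1}. \<Sum>\<mu>=1..N. \<Sum>\<nu>=1..L.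
      lweight Q \<nu> / 2 * (gweight Q \<mu> / 2 * (ystate \<sigma> \<tau> \<nu> \<mu> \<bullet> n)))"
    by (rule sum.swap)
  also have "\<dots> = (\<Sum>\<tau>\<in>{-1, 1}. \<Sum>\<sigma>\<in>{-1, 1}. \<Sum>\<nu>=1..L. \<Sum>\<mu>=1..N.
      lweight Q \<nu> / 2 * (gweight Q \<mu> / 2 * (ystate \<sigma> \<tau> \<nu> \<mu> \<bullet> n)))"
    by (intro sum.cong refl sum.swap)
  also have "\<dots> = (\<Sum>\<tau>\<in>{-1, 1}. \<Sum>\<nu>=1..L. \<Sum>\<sigma>\<in>{-1, 1}. \<Sum>\<mu>=1..N.
      lweight Q \<nu> / 2 * (gweight Q \<mu> / 2 * (ystate \<sigma> \<tau> \<nu> \<mu> \<bullet> n)))"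
    by (intro sum.cong refl sum.swap)
  also have "\<dots> = (\<Sum>\<tau>\<in>{-1, 1}. \<Sum>\<nu>=1..L. lweight Q \<nu> / 2 * (ymean \<tau> \<nu> - c))"
    unfolding mean_eq[symmetric] gavg_def by (intro sum.cong refl) (simp only: sum_distrib_left)
  finally show ?thesis
    unfolding right_diff_distrib sum_subtractf lobatto_const by simp
qed

text \<open>The arguments \<open>(-1, 1)\<close> and \<open>(1, L)\<close> are the outer nodes on
  the faces; \<open>(-1, L)\<close> and \<open>(1, 1)\<close> both lie on the centre line and lead
  to the vectors \<open>Pi_vec\<close>. Equality of the end weights puts one factor in front of all
  four.\<close>

lemma drop_interior:
  assumes "\<And>\<sigma> \<nu>. \<sigma> \<in> {-1, 1} \<Longrightarrow> \<nu> \<in> {1..L} \<Longrightarrow> f \<sigma> \<nu> > (0::real)"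
  shows "lweight Q 1 / 2 * (f (-1) 1 + f 1 L + f (-1) L + f 1 1)
    \<le> (\<Sum>\<sigma>\<in>{-1, 1 :: real}. \<Sum>\<nu>=1..L. lweight Q \<nu> / 2 * f \<sigma> \<nu>)"
proof -
  have "(\<Sum>\<nu>=2..L-1. lweight Q \<nu> / 2 * f \<sigma> \<nu>) \<ge> 0" if "\<sigma> \<in> {-1, 1}" for \<sigma>
    using assms that lw_pos by (intro sum_nonneg) (auto simp: less_imp_le)
  from this[of "-1"] this[of 1]
  show ?thesis
    unfolding lobatto_sum_ends[OF lobatto(2)] by (simp add: lw_sym algebra_simps)
qed

text \<open>States on opposite faces at the same Gauss node form an admissible pair; their flux
  estimates are then averaged.\<close>

lemma flux_gavg_bound:
  "gavg (\<lambda>\<tau> \<mu>. (flux p 1 (xstate 1 \<tau> L \<mu>) - flux p 1 (xstate (-1) \<tau> 1 \<mu>)) \<bullet> n)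
    \<le> a1 * (xmean 1 L + xmean (-1) 1) + gavg (\<lambda>\<tau> \<mu>. d 1 (xstate 1 \<tau> L \<mu>) - d 1 (xstate (-1) \<tau> 1 \<mu>))"
  "gavg (\<lambda>\<tau> \<mu>. (flux p 2 (ystate \<tau> 1 L \<mu>) - flux p 2 (ystate \<tau> (-1) 1 \<mu>)) \<bullet> n)
    \<le> a2 * (ymean 1 L + ymean (-1) 1) + gavg (\<lambda>\<tau> \<mu>. d 2 (ystate \<tau> 1 L \<mu>) - d 2 (ystate \<tau> (-1) 1 \<mu>))"
proof -
  have *: "(flux p l A - flux p l B) \<bullet> n \<le> \<alpha> * ((A \<bullet> n + c) + (B \<bullet> n + c)) + (d l A - d l B)"
    if "admissible_pair p l A B \<alpha>" for l A B \<alpha>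
    using flux_bound[OF that] admissible_pair.alpha_pos[OF that]
    by (simp add: inner_add_left field_simps)
  show "gavg (\<lambda>\<tau> \<mu>. (flux p 1 (xstate 1 \<tau> L \<mu>) - flux p 1 (xstate (-1) \<tau> 1 \<mu>)) \<bullet> n)
    \<le> a1 * (xmean 1 L + xmean (-1) 1) + gavg (\<lambda>\<tau> \<mu>. d 1 (xstate 1 \<tau> L \<mu>) - d 1 (xstate (-1) \<tau> 1 \<mu>))"
    unfolding xmean_def gavg_add[symmetric] gavg_cmult[symmetric]
    by (intro gavg_mono * face_pairs)
  show "gavg (\<lambda>\<tau> \<mu>. (flux p 2 (ystate \<tau> 1 L \<mu>) - flux p 2 (ystate \<tau> (-1) 1 \<mu>)) \<bullet> n)
    \<le> a2 * (ymean 1 L + ymean (-1) 1) + gavg (\<lambda>\<tau> \<mu>. d 2 (ystate \<tau> 1 L \<mu>) - d 2 (ystate \<tau> (-1) 1 \<mu>))"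
    unfolding ymean_def gavg_add[symmetric] gavg_cmult[symmetric]
    by (intro gavg_mono * face_pairs)
qed

text \<open>Since \<open>\<theta> = \<Delta>t / \<tau>max\<close>, the update is a convex
  combination of the two averages minus the flux differences, and \<open>c\<close> splits
  accordingly.\<close>

lemma updated_inner:
  "updated_avg p M Q \<tau>max \<Delta>t U W i j \<bullet> n + c
    = (1 - \<theta>) * (cell_avg M U i j \<bullet> n + c) + \<theta> * (cell_avg M W i j \<bullet> n + c)
      - \<Delta>t / dx M * gavg (\<lambda>\<tau> \<mu>. (flux p 1 (xstate 1 \<tau> L \<mu>) - flux p 1 (xstate (-1) \<tau> 1 \<mu>)) \<bullet> n)
      - \<Delta>t / dy M * gavg (\<lambda>\<tau> \<mu>. (flux p 2 (ystate \<tau> 1 L \<mu>) - flux p 2 (ystate \<tau> (-1) 1 \<mu>)) \<bullet> n)"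
proof -
  have X: "gavg (\<lambda>\<tau> \<mu>. (flux p 1 (W (xpos M (i + 1/2), gy M Q (j + \<tau>/4) \<mu>))
        - flux p 1 (W (xpos M (i - 1/2), gy M Q (j + \<tau>/4) \<mu>))) \<bullet> n)
      = gavg (\<lambda>\<tau> \<mu>. (flux p 1 (xstate 1 \<tau> L \<mu>) - flux p 1 (xstate (-1) \<tau> 1 \<mu>)) \<bullet> n)"
    by (intro gavg_cong) (simp only: face_values)
  have Y: "gavg (\<lambda>\<tau> \<mu>. (flux p 2 (W (gx M Q (i + \<tau>/4) \<mu>, ypos M (j + 1/2)))
        - flux p 2 (W (gx M Q (i + \<tau>/4) \<mu>, ypos M (j - 1/2)))) \<bullet> n)
      = gavg (\<lambda>\<tau> \<mu>. (flux p 2 (ystate \<tau> 1 L \<mu>) - flux p 2 (ystate \<tau> (-1) 1 \<mu>)) \<bullet> n)"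
    by (intro gavg_cong) (simp only: face_values)
  show ?thesis
    unfolding updated_avg_def cdg_rhs_def inner_add_left inner_diff_left[of "_ - _" _ n] inner_scaleR_left
      inner_diff_left[of "_ *\<^sub>R _" _ n]
    unfolding gavg_inner X Y
    by (simp add: theta(1) inner_diff_left algebra_simps)
qed

lemma update_bound:
  "updated_avg p M Q \<tau>max \<Delta>t U W i j \<bullet> n + c
    > \<theta> * lweight Q 1 / 2 *
        ((Pi_vec M Q lam1 lam2 W i j L (-1) + Pi_vec M Q lam1 lam2 W i j 1 1) \<bullet> n + 2 * c)
      - \<Delta>t * ddiv d"
proof -
  define l where "l = lam1 + lam2"
  have l: "l > 0" using lam_pos by (simp add: l_def)
  define \<kappa> where "\<kappa> = \<theta> * lweight Q 1 / 2"
  have kappa: "l < \<kappa>" using cfl by (simp add: l_def \<kappa>_def)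
  \<comment> \<open>Index 0 collects the outer nodes, which must absorb the fluxes; index 1 collects
    the inner ones, which survive in the bound.\<close>
  define X0 X1 where "X0 = xmean 1 L + xmean (-1) 1" and "X1 = xmean (-1) L + xmean 1 1"
  define Y0 Y1 where "Y0 = ymean 1 L + ymean (-1) 1" and "Y1 = ymean (-1) L + ymean 1 1"
  have P0: "X0 > 0" "Y0 > 0"
    unfolding X0_def Y0_def using mean_pos index_1L by (auto intro!: add_pos_pos)
  have Pi: "(Pi_vec M Q lam1 lam2 W i j L (-1) + Pi_vec M Q lam1 lam2 W i j 1 1) \<bullet> n + 2 * c
      = lam1 / l * X1 + lam2 / l * Y1"
    using Pi_inner[of "-1" L] Pi_inner[of 1 1] index_1L
    by (simp add: inner_add_left X1_def Y1_def l_def distrib_left)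
  have "lam1 / l + lam2 / l = 1" using l by (simp add: l_def add_divide_distrib[symmetric])
  have avgX: "\<theta> * (cell_avg M W i j \<bullet> n + c) \<ge> \<kappa> * (X0 + X1)"
    using mult_left_mono[OF drop_interior[of xmean] less_imp_le[OF theta(2)]] mean_pos(1)
    unfolding avg_inner_x by (simp add: \<kappa>_def X0_def X1_def algebra_simps)
  have avgY: "\<theta> * (cell_avg M W i j \<bullet> n + c) \<ge> \<kappa> * (Y0 + Y1)"
    using mult_left_mono[OF drop_interior[of ymean] less_imp_le[OF theta(2)]] mean_pos(2)
    unfolding avg_inner_y by (simp add: \<kappa>_def Y0_def Y1_def algebra_simps)
  \<comment> \<open>The two expansions of the same average are mixed with the weights occurring in
    \<open>Pi_vec\<close>, so that the inner nodes reproduce its contribution exactly.\<close>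
  have "lam1 / l * (\<kappa> * (X0 + X1)) + lam2 / l * (\<kappa> * (Y0 + Y1))
      \<le> lam1 / l * (\<theta> * (cell_avg M W i j \<bullet> n + c)) + lam2 / l * (\<theta> * (cell_avg M W i j \<bullet> n + c))"
    using avgX avgY lam_pos l by (intro add_mono mult_left_mono) auto
  also have "\<dots> = \<theta> * (cell_avg M W i j \<bullet> n + c)"
    using \<open>lam1 / l + lam2 / l = 1\<close> by (metis distrib_right mult_1)
  finally have avg_W: "\<kappa> * (lam1 / l * X1 + lam2 / l * Y1) + (\<kappa> / l) * (lam1 * X0 + lam2 * Y0)
      \<le> \<theta> * (cell_avg M W i j \<bullet> n + c)"
    by (simp add: algebra_simps add_divide_distrib)
  \<comment> \<open>The CFL condition gives the outer nodes a factor above 1 over what the fluxes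
    need; this is the source of the strict inequality.\<close>
  have "1 < \<kappa> / l" using kappa l by simp
  moreover have "lam1 * X0 + lam2 * Y0 > 0"
    using lam_pos P0 by (simp add: add_pos_pos)
  ultimately have strict: "lam1 * X0 + lam2 * Y0 < (\<kappa> / l) * (lam1 * X0 + lam2 * Y0)"
    using mult_strict_right_mono by fastforce
  have "\<Delta>t / dx M * gavg (\<lambda>\<tau> \<mu>. (flux p 1 (xstate 1 \<tau> L \<mu>) - flux p 1 (xstate (-1) \<tau> 1 \<mu>)) \<bullet> n)
      + \<Delta>t / dy M * gavg (\<lambda>\<tau> \<mu>. (flux p 2 (ystate \<tau> 1 L \<mu>) - flux p 2 (ystate \<tau> (-1) 1 \<mu>)) \<bullet> n)
      \<le> \<Delta>t / dx M * (a1 * X0 + gavg (\<lambda>\<tau> \<mu>. d 1 (xstate 1 \<tau> L \<mu>) - d 1 (xstate (-1) \<tau> 1 \<mu>)))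
      + \<Delta>t / dy M * (a2 * Y0 + gavg (\<lambda>\<tau> \<mu>. d 2 (ystate \<tau> 1 L \<mu>) - d 2 (ystate \<tau> (-1) 1 \<mu>)))"
    unfolding X0_def Y0_def using steps mesh by (intro add_mono mult_left_mono flux_gavg_bound) auto
  also have "\<dots> = lam1 * X0 + lam2 * Y0 + \<Delta>t * ddiv d"
    by (simp add: lam ddiv_def algebra_simps)
  finally have fl: "\<Delta>t / dx M * gavg (\<lambda>\<tau> \<mu>. (flux p 1 (xstate 1 \<tau> L \<mu>) - flux p 1 (xstate (-1) \<tau> 1 \<mu>)) \<bullet> n)
      + \<Delta>t / dy M * gavg (\<lambda>\<tau> \<mu>. (flux p 2 (ystate \<tau> 1 L \<mu>) - flux p 2 (ystate \<tau> (-1) 1 \<mu>)) \<bullet> n)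
      \<le> lam1 * X0 + lam2 * Y0 + \<Delta>t * ddiv d" .
  have "(1 - \<theta>) * (cell_avg M U i j \<bullet> n + c) \<ge> 0"
    using theta(3) pos[OF avg] by simp
  then show ?thesis
    unfolding updated_inner Pi \<kappa>_def[symmetric] using fl strict avg_W by linarith
qed

lemma Pi_sum_pos:
  "(Pi_vec M Q lam1 lam2 W i j L (-1) + Pi_vec M Q lam1 lam2 W i j 1 1) \<bullet> n + 2 * c > 0"
proof -
  have "Pi_vec M Q lam1 lam2 W i j \<nu> s \<bullet> n + c > 0" if "s \<in> {-1, 1}" "\<nu> \<in> {1..L}" for s \<nu>
    unfolding Pi_inner[OF that] using lam_pos mean_pos[OF that] by (simp add: add_pos_pos)
  from this[of "-1" L] this[of 1 1] index_1L show ?thesis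
    by (simp add: inner_add_left)
qed

end

section \<open>Density, energy and admissibility of the update\<close>

lemma kappa_pos: "\<theta> * lweight Q 1 / 2 > 0"
  using cfl lam_pos by linarith

text \<open>The cell bound with \<open>c = 0\<close> and zero observable; the remaining lower bound
  is positive by \<open>Pi_sum_pos\<close>.\<close>

lemma updated_n_one: "updated_avg p M Q \<tau>max \<Delta>t U W i j \<bullet> n_one > 0"
proof -
  have pos: "V \<bullet> n_one + 0 > 0" if "V \<in> admissible" for V
    using admissible_pos[OF that] by (simp add: inner_n_one)
  have fb: "(A + B) \<bullet> n_one + 2 * 0 - ((flux p l A - flux p l B) \<bullet> n_one - (0 - 0)) / \<alpha> \<ge> 0"
    if "admissible_pair p l A B \<alpha>" for l A B \<alpha>
    using admissible_pair.flux_n_one_nonneg[OF that] by simp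
  have dd: "ddiv (\<lambda>_ _. 0) = 0"
    by (simp add: ddiv_def gavg_const)
  show ?thesis
    using update_bound[OF pos fb] mult_pos_pos[OF kappa_pos Pi_sum_pos[OF pos fb]] dd by simp
qed

lemma updated_n_star:
  "updated_avg p M Q \<tau>max \<Delta>t U W i j \<bullet> n_star vs Bs + (norm Bs)\<^sup>2 / 2
    > \<theta> * lweight Q 1 / 2 *
        ((Pi_vec M Q lam1 lam2 W i j L (-1) + Pi_vec M Q lam1 lam2 W i j 1 1) \<bullet> n_star vs Bs + (norm Bs)\<^sup>2)
      - \<Delta>t * (vs \<bullet> Bs) * discrete_div M Q W i j"
  and Pi_n_star: "(Pi_vec M Q lam1 lam2 W i j L (-1) + Pi_vec M Q lam1 lam2 W i j 1 1)
    \<bullet> n_star vs Bs + (norm Bs)\<^sup>2 > 0"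
proof -
  \<comment> \<open>This is the part of the tested flux that has no sign; averaged over the faces it
    becomes \<open>vs \<bullet> Bs\<close> times the discrete divergence.\<close>
  define d where "d l V = (vs \<bullet> Bs) * mag V $ l" for l :: 3 and V
  have fb: "(A + B) \<bullet> n_star vs Bs + 2 * ((norm Bs)\<^sup>2 / 2)
      - ((flux p l A - flux p l B) \<bullet> n_star vs Bs - (d l A - d l B)) / \<alpha> \<ge> 0"
    if "admissible_pair p l A B \<alpha>" for l A B \<alpha>
    using admissible_pair.flux_n_star_nonneg[OF that] by (simp add: d_def algebra_simps)
  have X: "gavg (\<lambda>\<tau> \<mu>. d 1 (xstate 1 \<tau> L \<mu>) - d 1 (xstate (-1) \<tau> 1 \<mu>)) =
      (vs \<bullet> Bs) * gavg (\<lambda>\<tau> \<mu>. mag (W (xpos M (i + 1/2), gy M Q (j + \<tau>/4) \<mu>)) $ 1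
         - mag (W (xpos M (i - 1/2), gy M Q (j + \<tau>/4) \<mu>)) $ 1)"
    unfolding gavg_cmult[symmetric]
    by (intro gavg_cong) (simp only: face_values d_def right_diff_distrib)
  have Y: "gavg (\<lambda>\<tau> \<mu>. d 2 (ystate \<tau> 1 L \<mu>) - d 2 (ystate \<tau> (-1) 1 \<mu>)) =
      (vs \<bullet> Bs) * gavg (\<lambda>\<tau> \<mu>. mag (W (gx M Q (i + \<tau>/4) \<mu>, ypos M (j + 1/2))) $ 2
         - mag (W (gx M Q (i + \<tau>/4) \<mu>, ypos M (j - 1/2))) $ 2)"
    unfolding gavg_cmult[symmetric]
    by (intro gavg_cong) (simp only: face_values d_def right_diff_distrib)
  have dd: "ddiv d = (vs \<bullet> Bs) * discrete_div M Q W i j"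
    unfolding ddiv_def X Y discrete_div_def gavg_def[symmetric]
    by (simp add: algebra_simps)
  show "updated_avg p M Q \<tau>max \<Delta>t U W i j \<bullet> n_star vs Bs + (norm Bs)\<^sup>2 / 2
    > \<theta> * lweight Q 1 / 2 *
        ((Pi_vec M Q lam1 lam2 W i j L (-1) + Pi_vec M Q lam1 lam2 W i j 1 1) \<bullet> n_star vs Bs + (norm Bs)\<^sup>2)
      - \<Delta>t * (vs \<bullet> Bs) * discrete_div M Q W i j"
    using update_bound[OF inner_n_star_pos fb] by (simp add: dd mult.assoc)
  show "(Pi_vec M Q lam1 lam2 W i j L (-1) + Pi_vec M Q lam1 lam2 W i j 1 1)
    \<bullet> n_star vs Bs + (norm Bs)\<^sup>2 > 0"
    using Pi_sum_pos[OF inner_n_star_pos fb] by simp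
qed

lemma updated_admissible:
  assumes "discrete_div M Q W i j = 0"
  shows "updated_avg p M Q \<tau>max \<Delta>t U W i j \<in> admissible"
proof -
  define V where "V = updated_avg p M Q \<tau>max \<Delta>t U W i j"
  have r: "rho V > 0"
    using updated_n_one by (simp add: V_def inner_n_one)
  \<comment> \<open>The free vectors are taken to be the velocity and the magnetic field of the
    update itself, so that both squares in \<open>inner_n_star_eq\<close> vanish.\<close>
  have "V \<bullet> n_star (vel V) (mag V) + (norm (mag V))\<^sup>2 / 2 > 0"
    using updated_n_star[of "vel V" "mag V"] mult_pos_pos[OF kappa_pos Pi_n_star[of "vel V" "mag V"]]
    unfolding V_def[symmetric] by (simp add: assms)
  then have "internal_energy V > 0"
    by (simp add: inner_n_star_eq[OF r])
  with r show ?thesis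
    by (simp add: admissible_def V_def)
qed

end

section \<open>Neighbouring cells\<close>

lemma finite_ix: "finite (primal_ix M)" "finite (dual_ix M)"
  by (simp_all add: primal_ix_def dual_ix_def)

lemma finite_Qx: "finite (Qx M Q i)" and finite_Qy: "finite (Qy M Q j)"
  by (simp_all add: Qx_def Qy_def)

lemma half_shift_primal:
  assumes "i \<in> real ` {1..n}" "\<sigma> \<in> {-1, 1}"
  shows "i + \<sigma>/2 \<in> (\<lambda>i. real i + 1/2) ` {0..n}"
proof -
  obtain m where m: "i = real m" "1 \<le> m" "m \<le> n" using assms(1) by auto
  show ?thesis
  proof (cases "\<sigma> = 1")
    case True
    then show ?thesis using m by (intro image_eqI[of _ _ m]) auto
  next
    case False
    \<comment> \<open>The truncated difference \<open>m - 1\<close> is harmless since primal indices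
      start at 1.\<close>
    then show ?thesis using m assms(2) by (intro image_eqI[of _ _ "m - 1"]) (auto simp: of_nat_diff)
  qed
qed

text \<open>The extreme dual indices reach 0 and \<open>n + 1\<close>, the layer of ghost
  cells.\<close>

lemma half_shift_dual:
  assumes "i \<in> (\<lambda>i. real i + 1/2) ` {0..n}" "\<sigma> \<in> {-1, 1}"
  shows "i + \<sigma>/2 \<in> real ` {0..n + 1}"
proof -
  obtain m where m: "i = real m + 1/2" "m \<le> n" using assms(1) by auto
  show ?thesis
  proof (cases "\<sigma> = 1")
    case True
    then show ?thesis using m by (intro image_eqI[of _ _ "m + 1"]) auto
  next
    case False
    then show ?thesis using m assms(2) by (intro image_eqI[of _ _ m]) auto
  qed
qed

lemma primal_neighbour_dual:
  assumes "(i, j) \<in> primal_ix M" "\<sigma> \<in> {-1, 1}" "\<tau> \<in> {-1, 1}"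
  shows "(i + \<sigma>/2, j + \<tau>/2) \<in> dual_ix M"
  using assms half_shift_primal unfolding primal_ix_def dual_ix_def by blast

lemma dual_neighbour_primal:
  assumes "(i, j) \<in> dual_ix M" "\<sigma> \<in> {-1, 1}" "\<tau> \<in> {-1, 1}"
  shows "(i + \<sigma>/2, j + \<tau>/2) \<in> primal_ghost_ix M"
  using assms half_shift_dual unfolding primal_ghost_ix_def dual_ix_def by blast

lemma wave_bound_le_a_hat1:
  shows "(i, j) \<in> primal_ix M \<Longrightarrow> y \<in> Qy M Q j \<Longrightarrow>
      wave_bound p 1 (UD (xpos M (i + 1/2), y)) (UD (xpos M (i - 1/2), y)) \<le> a_hat1 p M Q UC UD"
    and "(i, j) \<in> dual_ix M \<Longrightarrow> y \<in> Qy M Q j \<Longrightarrow>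
      wave_bound p 1 (UC (xpos M (i + 1/2), y)) (UC (xpos M (i - 1/2), y)) \<le> a_hat1 p M Q UC UD"
  unfolding a_hat1_def by (rule Max_ge; force simp: finite_ix finite_Qy)+

lemma wave_bound_le_a_hat2:
  shows "(i, j) \<in> primal_ix M \<Longrightarrow> x \<in> Qx M Q i \<Longrightarrow>
      wave_bound p 2 (UD (x, ypos M (j + 1/2))) (UD (x, ypos M (j - 1/2))) \<le> a_hat2 p M Q UC UD"
    and "(i, j) \<in> dual_ix M \<Longrightarrow> x \<in> Qx M Q i \<Longrightarrow>
      wave_bound p 2 (UC (x, ypos M (j + 1/2))) (UC (x, ypos M (j - 1/2))) \<le> a_hat2 p M Q UC UD"
  unfolding a_hat2_def by (rule Max_ge; force simp: finite_ix finite_Qx)+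

theorem theorem4p1:
  fixes p :: eos and M :: mesh and Q :: quadrature and k :: nat
    and UC UD :: field2
    and a1 a2 \<Delta>t \<tau>max \<theta> lam1 lam2 :: real
  assumes eos: "\<And>r e. r > 0 \<Longrightarrow> p r e > 0 \<longleftrightarrow> e > 0"
    and mesh: "dx M > 0" "dy M > 0" "nx M \<ge> 1" "ny M \<ge> 1"
    and gauss: "gnum Q = k + 1" "gauss_rule (gnum Q) (gnode Q) (gweight Q)"
    and lobatto: "lnum Q = nat \<lceil>(real k + 3) / 2\<rceil>"
      "gauss_lobatto_rule (lnum Q) (lnode Q) (lweight Q)"
    and polyC: "\<And>i j. (i, j) \<in> primal_ghost_ix M \<Longrightarrow> polynomial_on k (cell M i j) UC"
    and polyD: "\<And>i j. (i, j) \<in> dual_ix M \<Longrightarrow> polynomial_on k (cell M i j) UD"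
    and avgC: "\<And>i j. (i, j) \<in> primal_ix M \<Longrightarrow> cell_avg M UC i j \<in> admissible"
    and avgD: "\<And>i j. (i, j) \<in> dual_ix M \<Longrightarrow> cell_avg M UD i j \<in> admissible"
    and nodes: "\<And>i j. (i, j) \<in> primal_ix M \<union> dual_ix M \<Longrightarrow>
      node_values M Q UC i j \<subseteq> admissible \<and> node_values M Q UD i j \<subseteq> admissible"
    and speeds: "a1 \<ge> a_hat1 p M Q UC UD" "a2 \<ge> a_hat2 p M Q UC UD"
    and steps: "\<Delta>t > 0" "\<tau>max > 0"
    and theta: "\<theta> = \<Delta>t / \<tau>max" "0 < \<theta>" "\<theta> \<le> 1"
    and lam: "lam1 = a1 * \<Delta>t / dx M" "lam2 = a2 * \<Delta>t / dy M"
    and cfl: "lam1 + lam2 < \<theta> * lweight Q 1 / 2"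
  shows "(\<forall>(i, j)\<in>primal_ix M. \<forall>vs Bs.
        updated_avg p M Q \<tau>max \<Delta>t UC UD i j \<bullet> n_one > 0 \<and>
        updated_avg p M Q \<tau>max \<Delta>t UC UD i j \<bullet> n_star vs Bs + (norm Bs)\<^sup>2 / 2
          > \<theta> * lweight Q 1 / 2 *
              ((Pi_vec M Q lam1 lam2 UD i j (lnum Q) (-1) + Pi_vec M Q lam1 lam2 UD i j 1 1)
                 \<bullet> n_star vs Bs + (norm Bs)\<^sup>2)
            - \<Delta>t * (vs \<bullet> Bs) * discrete_div M Q UD i j) \<and>
    (\<forall>(i, j)\<in>dual_ix M. \<forall>vs Bs.
        updated_avg p M Q \<tau>max \<Delta>t UD UC i j \<bullet> n_one > 0 \<and>
        updated_avg p M Q \<tau>max \<Delta>t UD UC i j \<bullet> n_star vs Bs + (norm Bs)\<^sup>2 / 2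
          > \<theta> * lweight Q 1 / 2 *
              ((Pi_vec M Q lam1 lam2 UC i j (lnum Q) (-1) + Pi_vec M Q lam1 lam2 UC i j 1 1)
                 \<bullet> n_star vs Bs + (norm Bs)\<^sup>2)
            - \<Delta>t * (vs \<bullet> Bs) * discrete_div M Q UC i j) \<and>
    ((\<forall>(i, j)\<in>primal_ix M. discrete_div M Q UD i j = 0) \<and>
     (\<forall>(i, j)\<in>dual_ix M. discrete_div M Q UC i j = 0) \<longrightarrow>
       (\<forall>(i, j)\<in>primal_ix M. updated_avg p M Q \<tau>max \<Delta>t UC UD i j \<in> admissible) \<and>
       (\<forall>(i, j)\<in>dual_ix M. updated_avg p M Q \<tau>max \<Delta>t UD UC i j \<in> admissible))"
proof -
  have C: "cell_update p M Q k UC UD i j a1 a2 \<Delta>t \<tau>max \<theta> lam1 lam2" if ij: "(i, j) \<in> primal_ix M" for i j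
  proof unfold_locales
    show "polynomial_on k (cell M (i + \<sigma>/2) (j + \<tau>/2)) UD" if "\<sigma> \<in> {-1, 1}" "\<tau> \<in> {-1, 1}" for \<sigma> \<tau>
      by (rule polyD[OF primal_neighbour_dual[OF ij that]])
    show "node_values M Q UD i j \<subseteq> admissible" using nodes ij by blast
    show "wave_bound p 1 (UD (xpos M (i + 1/2), y)) (UD (xpos M (i - 1/2), y)) \<le> a1"
      if "y \<in> Qy M Q j" for y
      using wave_bound_le_a_hat1(1)[OF ij that] speeds(1) by (rule order_trans)
    show "wave_bound p 2 (UD (x, ypos M (j + 1/2))) (UD (x, ypos M (j - 1/2))) \<le> a2"
      if "x \<in> Qx M Q i" for x
      using wave_bound_le_a_hat2(1)[OF ij that] speeds(2) by (rule order_trans)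
  qed (fact eos mesh gauss lobatto steps theta lam cfl avgC[OF ij])+
  \<comment> \<open>The same locale with the two fields exchanged; the neighbours now include the
    ghost cells.\<close>
  have D: "cell_update p M Q k UD UC i j a1 a2 \<Delta>t \<tau>max \<theta> lam1 lam2" if ij: "(i, j) \<in> dual_ix M" for i j
  proof unfold_locales
    show "polynomial_on k (cell M (i + \<sigma>/2) (j + \<tau>/2)) UC" if "\<sigma> \<in> {-1, 1}" "\<tau> \<in> {-1, 1}" for \<sigma> \<tau>
      by (rule polyC[OF dual_neighbour_primal[OF ij that]])
    show "node_values M Q UC i j \<subseteq> admissible" using nodes ij by blast
    show "wave_bound p 1 (UC (xpos M (i + 1/2), y)) (UC (xpos M (i - 1/2), y)) \<le> a1"
      if "y \<in> Qy M Q j" for y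
      using wave_bound_le_a_hat1(2)[OF ij that] speeds(1) by (rule order_trans)
    show "wave_bound p 2 (UC (x, ypos M (j + 1/2))) (UC (x, ypos M (j - 1/2))) \<le> a2"
      if "x \<in> Qx M Q i" for x
      using wave_bound_le_a_hat2(2)[OF ij that] speeds(2) by (rule order_trans)
  qed (fact eos mesh gauss lobatto steps theta lam cfl avgD[OF ij])+
  show ?thesis
    using cell_update.updated_n_one[OF C] cell_update.updated_n_star[OF C] cell_update.updated_admissible[OF C]
      cell_update.updated_n_one[OF D] cell_update.updated_n_star[OF D] cell_update.updated_admissible[OF D]
    by fast
qed

end
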